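(* For $M\in\mathrm{HP}$ let $t_M\in\mathrm{PT}$ be the unique permutation tree with $t_M^+=\mathrm{BT}(M)$. For any $M,N\in\mathrm{HP}$ the following are equivalent: (1) $\mathcal H^*\vdash M=N$; (2) $t_M\,\sigma_{\mathrm{PT}}\,t_N$; (3) $t_M^{\mathfrak m}=t_N^{\mathfrak m}$.
   Context: Permutation trees: a tree is a nonempty prefix-closed set $A\subseteq(\mathbb N^+)^*$, finitely branching, with $wj\in A$, $i<j$ implying $wi\in A$. A permutation tree is a map $t:A\to\mathrm{Sym}(\mathbb N^+)$ such that a node with exactly $n$ children is labelled by an element of $S_n$ (permutations of $\mathbb N^+$ fixing all $i>n$); trees may be infinite. Write $t=\langle\pi;t_1,\dots,t_n\rangle$ (root label $\pi\in S_n$, $t_i$ the subtree at child $i$); $\bar\epsilon$ is the one-node tree, $\iota$ the identity. $\mathrm{PT}$ is the set of permutation trees. Product (coinductive): $t\bar\epsilon=t=\bar\epsilon t$; for $t=\langle\pi;t_1..t_n\rangle$, $u=\langle\rho;u_1..u_m\rangle$: if $n\ge m$, $tu=\langle\pi\circ\rho;u_1t_{\rho1},\dots,u_mt_{\rho m},t_{m+1},\dots,t_n\rangle$; if $m\ge n$, $tu=\langle\pi\circ\rho;u_1t_{\rho1},\dots,u_mt_{\rho m}\rangle$ with $t_j:=\bar\epsilon$ for $j>n$. Inverse: $\bar\epsilon^*=\bar\epsilon$, $t^*=\langle\pi^{-1};(t_{\pi^{-1}1})^*,\dots,(t_{\pi^{-1}n})^*\rangle$. This is an inverse monoid; natural order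 $u\le v$ iff $uu^*v=u$; $t\,\sigma_{\mathrm{PT}}\,u$ iff some $w$ satisfies $w\le t,w\le u$. $E\subseteq\mathrm{PT}$ is the set of permutation trees all of whose labels are $\iota$. $t^{\mathfrak m}$ is defined coinductively: for $t=\langle\pi;t_1,\dots,t_n\rangle$, $t^{\mathfrak m}=(\langle\pi;t_1,\dots,t_{n-1}\rangle)^{\mathfrak m}$ if $t_n\in E$ and $\pi n=n$, else $t^{\mathfrak m}=\langle\pi;t_1^{\mathfrak m},\dots,t_n^{\mathfrak m}\rangle$ (and $\bar\epsilon^{\mathfrak m}=\bar\epsilon$). Lambda side: $\mathcal H^*\vdash M=N$ iff for every context $C[\,]$, $C[M]$ has a head normal form iff $C[N]$ has one. $\mathscr{HP}(x)$ is the largest set of Böhm-like trees with each $T$ of the form $\lambda x_1..x_n.x\,T_1\cdots T_n$, $\pi\in S_n$, $T_i\in\mathscr{HP}(x_{\pi i})$; $\mathscr{HP}=\{\lambda x.T\}$, $\mathrm{HP}=\{M:\mathrm{BT}(M)\in\mathscr{HP}\}$. The map $t\mapsto t^+$ is the bijection $\mathrm{PT}\to\mathscr{HP}$ defined coinductively by $\bar\epsilon^+=\lambda x.x$ and $\langle\pi;t_1,..,t_n\rangle^+=\lambda xx_1\dots x_n.x((t_1)^+x_{\pi1})\cdots((t_n)^+x_{\pi n})$, where application of Böhm-like trees is computed by $\beta$-reduction as for $\lambda$-terms. *)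

theory Defs
  imports Main "HOL-Combinatorics.Permutations"
begin

section \<open>Lambda terms, head normal forms, and the theory H*\<close>

text \<open>Terms are in de Bruijn notation: \<open>Var i\<close> is bound by the \<open>i\<close>-th enclosing \<open>Lam\<close>, counting
  from \<open>0\<close> outwards, and denotes a free variable if there are at most \<open>i\<close> enclosing \<open>Lam\<close>s.\<close>

datatype trm = Var nat | App trm trm | Lam trm

definition up_ren :: "(nat \<Rightarrow> nat) \<Rightarrow> nat \<Rightarrow> nat" where
  "up_ren f = case_nat 0 (\<lambda>i. Suc (f i))"

primrec ren :: "(nat \<Rightarrow> nat) \<Rightarrow> trm \<Rightarrow> trm" where
  "ren f (Var i) = Var (f i)"
| "ren f (App s t) = App (ren f s) (ren f t)"
| "ren f (Lam s) = Lam (ren (up_ren f) s)"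

primrec subst :: "(nat \<Rightarrow> trm) \<Rightarrow> trm \<Rightarrow> trm" where
  "subst \<sigma> (Var i) = \<sigma> i"
| "subst \<sigma> (App s t) = App (subst \<sigma> s) (subst \<sigma> t)"
| "subst \<sigma> (Lam s) = Lam (subst (case_nat (Var 0) (\<lambda>i. ren Suc (\<sigma> i))) s)"

definition contract :: "trm \<Rightarrow> trm \<Rightarrow> trm" where
  "contract s t = subst (case_nat t Var) s"

inductive beta :: "trm \<Rightarrow> trm \<Rightarrow> bool" where
  "beta (App (Lam s) t) (contract s t)"
| "beta s s' \<Longrightarrow> beta (App s t) (App s' t)"
| "beta t t' \<Longrightarrow> beta (App s t) (App s t')"
| "beta s s' \<Longrightarrow> beta (Lam s) (Lam s')"

abbreviation lams :: "nat \<Rightarrow> trm \<Rightarrow> trm" where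
  "lams n M \<equiv> (Lam ^^ n) M"

abbreviation apps :: "trm \<Rightarrow> trm list \<Rightarrow> trm" where
  "apps M Ms \<equiv> foldl App M Ms"

inductive head_red :: "trm \<Rightarrow> trm \<Rightarrow> bool" where
  "head_red (lams n (apps (App (Lam P) Q) Ms)) (lams n (apps (contract P Q) Ms))"

definition is_hnf :: "trm \<Rightarrow> bool" where
  "is_hnf M \<longleftrightarrow> (\<exists>n x Ms. M = lams n (apps (Var x) Ms))"

definition has_hnf :: "trm \<Rightarrow> bool" where
  "has_hnf M \<longleftrightarrow> (\<exists>N. beta\<^sup>*\<^sup>* M N \<and> is_hnf N)"

text \<open>Contexts may have any number of holes.  Filling a hole does not shift indices, so that free
  variables of the inserted term may be captured by the context.\<close>

datatype ctxt = Hole | CVar nat | CApp ctxt ctxt | CLam ctxt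

primrec fill :: "ctxt \<Rightarrow> trm \<Rightarrow> trm" where
  "fill Hole M = M"
| "fill (CVar i) M = Var i"
| "fill (CApp C D) M = App (fill C M) (fill D M)"
| "fill (CLam C) M = Lam (fill C M)"

definition H_star :: "trm \<Rightarrow> trm \<Rightarrow> bool" where
  "H_star M N \<longleftrightarrow> (\<forall>C. has_hnf (fill C M) \<longleftrightarrow> has_hnf (fill C N))"


section \<open>Boehm trees\<close>

text \<open>\<open>Hnf n h [T\<^sub>1, \<dots>, T\<^sub>m]\<close> is the Boehm-like tree \<open>\<lambda>x\<^sub>1 \<dots> x\<^sub>n. h T\<^sub>1 \<cdots> T\<^sub>m\<close>; the index \<open>h\<close> and the free
  indices of the \<open>T\<^sub>i\<close> are read below the \<open>n\<close> binders, so that \<open>x\<^sub>j\<close> has index \<open>n - j\<close> and the variable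
  with index \<open>k\<close> outside has index \<open>k + n\<close>.\<close>

codatatype bt = Bot | Hnf nat nat "bt list"

text \<open>The principal head normal form.  Head reduction is deterministic, hence the choice is unique
  whenever head reduction terminates.\<close>

definition phnf :: "trm \<Rightarrow> nat \<times> nat \<times> trm list" where
  "phnf M = (SOME (n, x, Ms). head_red\<^sup>*\<^sup>* M (lams n (apps (Var x) Ms)))"

primcorec BT :: "trm \<Rightarrow> bt" where
  "BT M = (if has_hnf M
     then Hnf (fst (phnf M)) (fst (snd (phnf M))) (map BT (snd (snd (phnf M))))
     else Bot)"

fun bt_lam :: "bt \<Rightarrow> bt" where
  "bt_lam Bot = Bot"
| "bt_lam (Hnf n h Ts) = Hnf (Suc n) h Ts"

primcorec bt_ren :: "(nat \<Rightarrow> nat) \<Rightarrow> bt \<Rightarrow> bt" where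
  "bt_ren f T = (case T of Bot \<Rightarrow> Bot
     | Hnf n h Ts \<Rightarrow> Hnf n ((up_ren ^^ n) f h) (map (bt_ren ((up_ren ^^ n) f)) Ts))"

text \<open>Application of a tree to the variable with index \<open>j\<close>.  One \<open>\<beta>\<close>-step
  \<open>(\<lambda>x. T) y \<rightarrow> T[x := y]\<close> suffices, since replacing a variable by a variable creates no redex.\<close>

fun bt_app_var :: "bt \<Rightarrow> nat \<Rightarrow> bt" where
  "bt_app_var Bot j = Bot"
| "bt_app_var (Hnf 0 h Ts) j = Hnf 0 h (Ts @ [Hnf 0 j []])"
| "bt_app_var (Hnf (Suc n) h Ts) j = bt_ren (case_nat j id) (Hnf n h Ts)"


section \<open>Hereditary permutations\<close>

text \<open>\<open>HPx k T\<close>: the tree \<open>T\<close> belongs to HP(x), where \<open>x\<close> is the variable with index \<open>k\<close>.\<close>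

coinductive HPx :: "nat \<Rightarrow> bt \<Rightarrow> bool" where
  "\<lbrakk>length Ts = n; \<pi> permutes {1..n}; \<And>i. i \<in> {1..n} \<Longrightarrow> HPx (n - \<pi> i) (Ts ! (i - 1))\<rbrakk>
   \<Longrightarrow> HPx k (Hnf n (k + n) Ts)"

definition HP_trees :: "bt set" where
  "HP_trees = {bt_lam T | T. HPx 0 T}"

definition HP :: "trm set" where
  "HP = {M. BT M \<in> HP_trees}"


section \<open>Permutation trees\<close>

text \<open>Possibly infinite, finitely branching ordered trees with labelled nodes.  The codatatype
  provides \<open>labels t\<close>, the set of all labels of \<open>t\<close>.\<close>

codatatype (labels: 'a) tree = Node (label: 'a) (subtrees: "'a tree list")

text \<open>The permutations of the positive integers are the permutations of \<open>nat\<close> fixing \<open>0\<close>.\<close>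

type_synonym ptree = "(nat \<Rightarrow> nat) tree"

coinductive_set PT :: "ptree set" where
  "\<lbrakk>\<pi> permutes {1..length ts}; \<And>t. t \<in> set ts \<Longrightarrow> t \<in> PT\<rbrakk> \<Longrightarrow> Node \<pi> ts \<in> PT"

definition eps :: ptree where
  "eps = Node id []"

abbreviation arity :: "ptree \<Rightarrow> nat" where
  "arity t \<equiv> length (subtrees t)"

text \<open>Children are numbered from \<open>1\<close>; nonexistent children count as \<open>eps\<close>.\<close>

definition child :: "ptree \<Rightarrow> nat \<Rightarrow> ptree" where
  "child t i = (if i \<in> {1..arity t} then subtrees t ! (i - 1) else eps)"

primcorec pt_mult :: "ptree \<Rightarrow> ptree \<Rightarrow> ptree" (infixl "\<cdot>" 70) where
  "t \<cdot> u = Node (label t \<circ> label u)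
     (map (\<lambda>i. if i \<le> arity u then child u i \<cdot> child t (label u i) else child t i)
        [1..<Suc (max (arity t) (arity u))])"

lemma pt_mult_eps: "t \<cdot> eps = t"
  by (rule tree.expand) (auto simp: eps_def child_def simp del: upt_Suc intro!: nth_equalityI)

lemma eps_pt_mult: "eps \<cdot> t = t"
proof (coinduction arbitrary: t rule: tree.coinduct_strong)
  case Eq_tree
  have "child t (Suc j) \<cdot> eps = subtrees t ! j" if "j < arity t" for j
    using that by (simp add: pt_mult_eps child_def)
  then show ?case
    by (auto simp: eps_def child_def list_all2_conv_all_nth simp del: upt_Suc)
qed

primcorec pt_star :: "ptree \<Rightarrow> ptree" where
  "pt_star t = Node (inv (label t)) (map (\<lambda>i. pt_star (child t (inv (label t) i))) [1..<Suc (arity t)])"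

definition pt_le :: "ptree \<Rightarrow> ptree \<Rightarrow> bool" where
  "pt_le u v \<longleftrightarrow> u \<cdot> pt_star u \<cdot> v = u"

definition sigma_PT :: "ptree \<Rightarrow> ptree \<Rightarrow> bool" where
  "sigma_PT t u \<longleftrightarrow> (\<exists>w\<in>PT. pt_le w t \<and> pt_le w u)"

definition E :: "ptree set" where
  "E = {t \<in> PT. labels t \<subseteq> {id}}"

function trim :: "(nat \<Rightarrow> nat) \<Rightarrow> ptree list \<Rightarrow> ptree list" where
  "trim \<pi> ts = (if ts \<noteq> [] \<and> last ts \<in> E \<and> \<pi> (length ts) = length ts
     then trim \<pi> (butlast ts) else ts)"
  by auto
termination by (relation "measure (\<lambda>(\<pi>, ts). length ts)") auto

declare trim.simps [simp del]

primcorec mform :: "ptree \<Rightarrow> ptree" where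
  "mform t = Node (label t) (map mform (trim (label t) (subtrees t)))"

lemma mform_snoc:
  "mform (Node \<pi> (ts @ [t])) =
    (if t \<in> E \<and> \<pi> (Suc (length ts)) = Suc (length ts) then mform (Node \<pi> ts)
     else Node \<pi> (map mform (ts @ [t])))"
  by (subst (1 2) mform.code) (simp add: trim.simps[of \<pi> "ts @ [t]"])

lemma mform_eps: "mform eps = eps"
  by (subst mform.code) (simp add: eps_def trim.simps)


section \<open>From permutation trees to hereditary permutations\<close>

text \<open>\<open>pt_body k t\<close> is \<open>t\<^sup>+ x\<close> for the variable \<open>x\<close> with index \<open>k\<close>; it serves to make the corecursion
  for \<open>t\<^sup>+\<close> primitive.  The defining equation of \<open>t\<^sup>+\<close> is \<open>pt_plus_Node\<close> below.\<close>

primcorec pt_body :: "nat \<Rightarrow> ptree \<Rightarrow> bt" where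
  "pt_body k t = Hnf (arity t) (k + arity t)
     (map (\<lambda>i. pt_body (arity t - label t i) (child t i)) [1..<Suc (arity t)])"

definition pt_plus :: "ptree \<Rightarrow> bt" where
  "pt_plus t = bt_lam (pt_body 0 t)"

lemma up_ren_pow_less: "i < n \<Longrightarrow> (up_ren ^^ n) f i = i"
  by (induction n arbitrary: i) (auto simp: up_ren_def split: nat.split)

lemma up_ren_pow_add: "(up_ren ^^ n) f (k + n) = f k + n"
  by (induction n) (auto simp: up_ren_def)

lemma bt_ren_Hnf:
  "bt_ren f (Hnf n h Ts) = Hnf n ((up_ren ^^ n) f h) (map (bt_ren ((up_ren ^^ n) f)) Ts)"
  by (subst bt_ren.code) simp

lemma PT_label: "t \<in> PT \<Longrightarrow> label t permutes {1..arity t}"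
  by (erule PT.cases) simp

lemma PT_child: "t \<in> PT \<Longrightarrow> i \<in> {1..arity t} \<Longrightarrow> child t i \<in> PT"
  by (erule PT.cases) (auto simp: child_def)

lemma PT_label_in: "t \<in> PT \<Longrightarrow> i \<in> {1..arity t} \<Longrightarrow> label t i \<in> {1..arity t}"
  using PT_label permutes_in_image by metis

lemma bt_ren_body: "t \<in> PT \<Longrightarrow> bt_ren f (pt_body k t) = pt_body (f k) t"
proof (coinduction arbitrary: t f k rule: bt.coinduct_strong)
  case (Eq_bt t f k)
  let ?n = "arity t"
  have "\<exists>t' f' k'. bt_ren ((up_ren ^^ ?n) f) (pt_body (?n - label t i) (child t i)) = bt_ren f' (pt_body k' t') \<and>
      pt_body (?n - label t i) (child t i) = pt_body (f' k') t' \<and> t' \<in> PT"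
    if i: "i \<in> {1..?n}" for i
  proof -
    have "label t i \<ge> 1" "?n \<ge> 1"
      using PT_label_in[OF Eq_bt i] i by auto
    then have "(up_ren ^^ ?n) f (?n - label t i) = ?n - label t i"
      by (intro up_ren_pow_less) simp
    then show ?thesis using PT_child[OF Eq_bt i] by metis
  qed
  then show ?case
    by (subst (1 2 3 4 5) pt_body.code)
       (auto simp: bt_ren_Hnf up_ren_pow_add list.rel_map intro!: list.rel_refl_strong)
qed

theorem pt_plus_Node:
  assumes "Node \<pi> ts \<in> PT" and n: "n = length ts"
  shows "pt_plus (Node \<pi> ts) =
    bt_lam (Hnf n n (map (\<lambda>i. bt_app_var (pt_plus (ts ! (i - 1))) (n - \<pi> i)) [1..<Suc n]))"
proof -
  have "pt_body (n - \<pi> i) (ts ! (i - 1)) = bt_app_var (pt_plus (ts ! (i - 1))) (n - \<pi> i)"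
    if "i \<in> {1..n}" for i
  proof -
    have "ts ! (i - 1) \<in> PT"
      using PT_child[OF assms(1), of i] that n by (simp add: child_def)
    from bt_ren_body[OF this, of "case_nat (n - \<pi> i) id" 0]
    show ?thesis unfolding pt_plus_def
      by (simp add: pt_body.code[of 0] del: upt_Suc)
  qed
  then show ?thesis
    unfolding pt_plus_def
    by (subst pt_body.code) (auto simp: n child_def)
qed

lemma bt_lam_inject: "bt_lam S = bt_lam T \<Longrightarrow> S = T"
  by (cases S; cases T) auto

lemma HPx_body: "t \<in> PT \<Longrightarrow> HPx k (pt_body k t)"
proof (coinduction arbitrary: t k)
  case HPx
  have *: "\<exists>k t'. arity t - label t i = k \<and>
      pt_body (arity t - label t i) (child t i) = pt_body k t' \<and> t' \<in> PT" if "i \<in> {1..arity t}" for i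
    using PT_child[OF HPx that] by blast
  show ?case
    apply (rule exI[of _ "map (\<lambda>i. pt_body (arity t - label t i) (child t i)) [1..<Suc (arity t)]"])
    apply (rule exI[of _ "arity t"], rule exI[of _ "label t"], rule exI[of _ k])
    apply (use PT_label[OF HPx] * in \<open>auto simp: pt_body.code[of k t] simp del: upt_Suc\<close>)
    done
qed

lemma body_inject:
  assumes "t \<in> PT" "u \<in> PT" "pt_body k t = pt_body l u"
  shows "k = l \<and> t = u"
proof -
  have step: "k = l \<and> arity t = arity u \<and> label t = label u \<and>
      (\<forall>i\<in>{1..arity t}. pt_body (arity t - label t i) (child t i) = pt_body (arity t - label t i) (child u i))"
    if tu: "t \<in> PT" "u \<in> PT" "pt_body k t = pt_body l u" for t u k l
  proof -
    have n: "arity t = arity u" and k: "k = l"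
      and c: "\<And>i. i \<in> {1..arity t} \<Longrightarrow>
        pt_body (arity t - label t i) (child t i) = pt_body (arity t - label u i) (child u i)"
      using tu(3) by (subst (asm) (1 2) pt_body.code, auto)+
    have "label t i = label u i" for i
    proof (cases "i \<in> {1..arity t}")
      case True
      have "arity t - label t i = arity t - label u i"
        using c[OF True] by (subst (asm) (1 2) pt_body.code) auto
      then show ?thesis
        using PT_label_in[OF tu(1) True] PT_label_in[OF tu(2), of i] True n by auto
    next
      case False
      then show ?thesis
        using PT_label[OF tu(1)] PT_label[OF tu(2)] n by (metis permutes_not_in)
    qed
    then have "label t = label u" by blast
    with n k c show ?thesis by simp
  qed
  have "t = u"
    using assms
  proof (coinduction arbitrary: t u k l)
    case (Eq_tree t u k l)
    note s = step[OF Eq_tree]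
    have "\<exists>t' u' k l. subtrees t ! j = t' \<and> subtrees u ! j = u' \<and> t' \<in> PT \<and> u' \<in> PT \<and> pt_body k t' = pt_body l u'"
      if "j < arity t" for j
    proof -
      have "Suc j \<in> {1..arity t}" using that by simp
      with s PT_child[OF Eq_tree(1), of "Suc j"] PT_child[OF Eq_tree(2), of "Suc j"]
      show ?thesis by (force simp: child_def)
    qed
    with s show ?case by (auto simp: list_all2_conv_all_nth)
  qed
  with step[OF assms] show ?thesis by blast
qed

text \<open>An inverse of \<open>pt_body k\<close>, needed only to prove surjectivity.\<close>

definition HP_perm :: "nat \<Rightarrow> bt list \<Rightarrow> nat \<Rightarrow> nat" where
  "HP_perm n Ts = (SOME \<pi>. \<pi> permutes {1..n} \<and> (\<forall>i\<in>{1..n}. HPx (n - \<pi> i) (Ts ! (i - 1))))"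

primcorec unbody :: "bt \<Rightarrow> ptree" where
  "unbody T = (case T of Bot \<Rightarrow> Node id [] | Hnf n h Ts \<Rightarrow> Node (HP_perm n Ts) (map unbody Ts))"

lemma HPx_cases_perm:
  assumes "HPx k T"
  obtains n Ts where "T = Hnf n (k + n) Ts" "length Ts = n" "HP_perm n Ts permutes {1..n}"
    "\<And>i. i \<in> {1..n} \<Longrightarrow> HPx (n - HP_perm n Ts i) (Ts ! (i - 1))"
    "unbody T = Node (HP_perm n Ts) (map unbody Ts)"
proof -
  from assms obtain n Ts \<pi> where T: "T = Hnf n (k + n) Ts" "length Ts = n"
    and \<pi>: "\<pi> permutes {1..n} \<and> (\<forall>i\<in>{1..n}. HPx (n - \<pi> i) (Ts ! (i - 1)))"
    by (cases rule: HPx.cases) blast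
  from someI[of "\<lambda>\<pi>. \<pi> permutes {1..n} \<and> (\<forall>i\<in>{1..n}. HPx (n - \<pi> i) (Ts ! (i - 1)))", OF \<pi>]
  have "HP_perm n Ts permutes {1..n} \<and> (\<forall>i\<in>{1..n}. HPx (n - HP_perm n Ts i) (Ts ! (i - 1)))"
    unfolding HP_perm_def .
  moreover have "unbody T = Node (HP_perm n Ts) (map unbody Ts)"
    by (subst unbody.code) (simp add: T)
  ultimately show thesis using T that by blast
qed

lemma unbody_PT: "HPx k T \<Longrightarrow> unbody T \<in> PT"
proof (coinduction arbitrary: k T)
  case PT
  then show ?case
  proof (cases rule: HPx_cases_perm)
    case (1 n Ts)
    have "\<exists>k. HPx k S" if "S \<in> set Ts" for S
    proof -
      from that obtain j where "j < n" "S = Ts ! j"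
        using 1(2) by (auto simp: in_set_conv_nth)
      then show ?thesis using 1(4)[of "Suc j"] by auto
    qed
    with 1(1,2,3,5) show ?thesis by fastforce
  qed
qed

lemma body_unbody: "HPx k T \<Longrightarrow> pt_body k (unbody T) = T"
proof (coinduction arbitrary: k T)
  case (Eq_bt k T)
  then show ?case
  proof (cases rule: HPx_cases_perm)
    case (1 n Ts)
    have "\<exists>k' T'. pt_body (n - HP_perm n Ts (Suc j)) (child (unbody T) (Suc j)) = pt_body k' (unbody T') \<and>
        Ts ! j = T' \<and> HPx k' T'" if "j < n" for j
      using 1(2,5) 1(4)[of "Suc j"] that by (auto simp: child_def)
    then show ?thesis
      using 1(1,2,5) by (simp add: list_all2_conv_all_nth del: upt_Suc)
  qed
qed

lemma HPx_imp_body: "HPx k T \<Longrightarrow> \<exists>t\<in>PT. pt_body k t = T"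
  using unbody_PT body_unbody by blast

theorem bij_betw_pt_plus: "bij_betw pt_plus PT HP_trees"
  unfolding bij_betw_def inj_on_def HP_trees_def pt_plus_def
  using HPx_body HPx_imp_body body_inject bt_lam_inject by (auto simp: image_iff) blast+

corollary ex1_pt_plus:
  assumes "M \<in> HP"
  shows "\<exists>!t. t \<in> PT \<and> pt_plus t = BT M"
proof -
  have "BT M \<in> pt_plus ` PT"
    using assms bij_betw_imp_surj_on[OF bij_betw_pt_plus] by (simp add: HP_def)
  then show ?thesis
    using bij_betw_imp_inj_on[OF bij_betw_pt_plus] by (auto simp: inj_on_def)
qed

definition pt_of :: "trm \<Rightarrow> ptree" where
  "pt_of M = (THE t. t \<in> PT \<and> pt_plus t = BT M)"

end

theory Submission
  imports Defs
begin

text \<open>All three conditions say that the labels of the two trees agree at every word over the positive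
  integers, nonexistent children being read as \<open>eps\<close>; this is the function \<open>lab\<close>.

  A tree \<open>w\<close> lies below \<open>t\<close> in the natural order iff it has the same \<open>lab\<close> and at least as many
  children everywhere, so two trees with equal \<open>lab\<close> have their union as a common lower bound.
  The normal form \<open>mform\<close> is a canonical representative of a \<open>lab\<close> class.

  For H* we use an extensional filter model (intersection types in which the base type is
  identified with \<open>[] \<rightarrow> Base\<close>): a term has a head normal form iff its value in the environment with
  all variables interpreted by the full set of types is nonempty.  By induction on types, the value of
  \<open>t\<^sup>+ x\<close> only depends on \<open>lab t\<close>, which gives one direction.  For the other one, a Boehm-out argument
  with selectors as arguments follows a word at which the labels differ.\<close>

section \<open>Labels of permutation trees\<close>

primrec lab :: "ptree \<Rightarrow> nat list \<Rightarrow> nat \<Rightarrow> nat" where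
  "lab t [] = label t"
| "lab t (i # w) = lab (child t i) w"

lemma eps_PT: "eps \<in> PT"
  unfolding eps_def by (rule PT.intros) (auto simp: permutes_def)

lemma arity_eps [simp]: "arity eps = 0"
  by (simp add: eps_def)

lemma label_eps [simp]: "label eps = id"
  by (simp add: eps_def)

lemma child_eps [simp]: "child eps i = eps"
  by (simp add: child_def)

lemma lab_eps [simp]: "lab eps w = id"
  by (induction w) auto

lemma child_0 [simp]: "child t 0 = eps"
  by (simp add: child_def)

lemma child_beyond: "arity t < i \<Longrightarrow> child t i = eps"
  by (simp add: child_def)

lemma child_PT: "t \<in> PT \<Longrightarrow> child t i \<in> PT"
  using PT_child by (cases "i \<in> {1..arity t}") (auto simp: child_def eps_PT)

lemma label_beyond: "t \<in> PT \<Longrightarrow> arity t < i \<Longrightarrow> label t i = i"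
  by (rule permutes_not_in[OF PT_label]) auto

lemma label_0: "t \<in> PT \<Longrightarrow> label t 0 = 0"
  by (rule permutes_not_in[OF PT_label]) auto

lemma label_le:
  assumes "t \<in> PT" "arity t \<le> p" "i \<in> {1..p}"
  shows "label t i \<in> {1..p}"
  using assms PT_label_in[of t i] label_beyond[of t i] by (cases "i \<le> arity t") auto

lemma subtrees_conv_child: "t \<in> set (subtrees u) \<longleftrightarrow> (\<exists>i\<in>{1..arity u}. t = child u i)"
proof
  assume "t \<in> set (subtrees u)"
  then obtain j where "j < arity u" "t = subtrees u ! j"
    by (auto simp: in_set_conv_nth)
  then show "\<exists>i\<in>{1..arity u}. t = child u i"
    by (intro bexI[of _ "Suc j"]) (auto simp: child_def)
qed (auto simp: child_def)

text \<open>Coinduction in terms of \<open>child\<close>, so that for products, inverses and unions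
  it suffices to compute the label, the arity and the children.\<close>

lemma PT_coinduct_child:
  assumes "X t"
    and step: "\<And>t. X t \<Longrightarrow> label t permutes {1..arity t} \<and> (\<forall>i\<in>{1..arity t}. X (child t i))"
  shows "t \<in> PT"
  using assms(1)
proof (coinduction arbitrary: t)
  case (PT t)
  then show ?case
    using step[OF PT]
    by (intro exI[of _ "label t"] exI[of _ "subtrees t"]) (auto simp: subtrees_conv_child)
qed

lemma tree_coinduct_child:
  assumes "X t u"
    and step: "\<And>t u. X t u \<Longrightarrow> label t = label u \<and> arity t = arity u \<and>
      (\<forall>i\<in>{1..arity t}. X (child t i) (child u i))"
  shows "t = u"
  using assms(1)
proof (coinduction arbitrary: t u)
  case (Eq_tree t u)
  have "X (subtrees t ! j) (subtrees u ! j)" if "j < arity t" for j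
    using step[OF Eq_tree] that by (auto simp: child_def dest!: bspec[of _ _ "Suc j"])
  then show ?case
    using step[OF Eq_tree] by (auto simp: list_all2_conv_all_nth)
qed

text \<open>Words reach exactly the nodes of \<open>t\<close> and, beyond them, copies of
  \<open>eps\<close>, whose label is the identity. One direction is an induction on the word, the
  other on the membership in \<open>labels t\<close>.\<close>

lemma E_iff_lab:
  assumes "t \<in> PT"
  shows "t \<in> E \<longleftrightarrow> (\<forall>w. lab t w = id)"
proof
  assume "t \<in> E"
  then have "labels t \<subseteq> {id}"
    by (simp add: E_def)
  then have "lab t w = id" for w
  proof (induction w arbitrary: t)
    case Nil
    then show ?case by (cases t) auto
  next
    case (Cons i w)
    have "child t i = eps \<or> child t i \<in> set (subtrees t)"
      by (auto simp: child_def)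
    then have "labels (child t i) \<subseteq> labels t \<union> {id}"
      by (cases t) (auto simp: eps_def)
    then have "labels (child t i) \<subseteq> {id}"
      using Cons.prems by (auto simp: id_def)
    then have "lab (child t i) w = id" by (rule Cons.IH)
    then show ?case by simp
  qed
  then show "\<forall>w. lab t w = id" ..
next
  assume *: "\<forall>w. lab t w = id"
  have "x = id" if "x \<in> labels t" for x
    using that *
  proof (induction x t rule: tree.set_induct)
    case (Node1 x ts)
    show ?case using Node1[rule_format, of "[]"] by simp
  next
    case (Node2 x ts s y)
    obtain i where "s = child (Node x ts) i"
      using Node2(1) subtrees_conv_child[of s "Node x ts"] by auto
    then have "lab s w = id" for w
      using Node2.prems[rule_format, of "i # w"] by simp
    then show ?case by (intro Node2.IH) blast
  qed
  then show "t \<in> E" using assms by (auto simp: E_def)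
qed

section \<open>Trimming and the normal form\<close>

lemma trim_take: "\<exists>m\<le>length ts. trim \<pi> ts = take m ts \<and>
    (\<forall>i\<in>{m<..length ts}. ts ! (i - 1) \<in> E \<and> \<pi> i = i) \<and>
    (m \<noteq> 0 \<longrightarrow> \<not> (ts ! (m - 1) \<in> E \<and> \<pi> m = m))"
proof (induction ts rule: rev_induct)
  case Nil
  show ?case by (simp add: trim.simps)
next
  case (snoc t ts)
  show ?case
  proof (cases "t \<in> E \<and> \<pi> (Suc (length ts)) = Suc (length ts)")
    case True
    obtain m where "m \<le> length ts" "trim \<pi> ts = take m ts"
      "\<forall>i\<in>{m<..length ts}. ts ! (i - 1) \<in> E \<and> \<pi> i = i"
      "m \<noteq> 0 \<longrightarrow> \<not> (ts ! (m - 1) \<in> E \<and> \<pi> m = m)"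
      using snoc by blast
    then show ?thesis
      using True by (intro exI[of _ m]) (auto simp: trim.simps[of \<pi> "ts @ [t]"] nth_append le_Suc_eq)
  next
    case False
    then show ?thesis
      by (intro exI[of _ "Suc (length ts)"]) (auto simp: trim.simps[of \<pi> "ts @ [t]"])
  qed
qed

definition trimmed_arity :: "ptree \<Rightarrow> nat" where
  "trimmed_arity t = length (trim (label t) (subtrees t))"

lemma trimmed_arity_le: "trimmed_arity t \<le> arity t"
  using trim_take[of "subtrees t" "label t"] by (auto simp: trimmed_arity_def)

lemma trim_conv_take: "trim (label t) (subtrees t) = take (trimmed_arity t) (subtrees t)"
  using trim_take[of "subtrees t" "label t"] by (auto simp: trimmed_arity_def)

lemma beyond_trimmed:
  assumes "t \<in> PT" "trimmed_arity t < i"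
  shows "child t i \<in> E \<and> label t i = i"
proof (cases "i \<le> arity t")
  case True
  then show ?thesis
    using trim_take[of "subtrees t" "label t"] assms(2)
    by (auto simp: trimmed_arity_def child_def)
next
  case False
  then show ?thesis
    using assms(1) by (simp add: child_beyond label_beyond E_iff_lab eps_PT)
qed

lemma at_trimmed:
  assumes "trimmed_arity t \<noteq> 0"
  shows "\<not> (child t (trimmed_arity t) \<in> E \<and> label t (trimmed_arity t) = trimmed_arity t)"
  using trim_take[of "subtrees t" "label t"] assms
  by (auto simp: trimmed_arity_def child_def)

lemma arity_mform: "arity (mform t) = trimmed_arity t"
  by (simp add: trimmed_arity_def)

lemma child_mform: "i \<in> {1..trimmed_arity t} \<Longrightarrow> child (mform t) i = mform (child t i)"
  using trimmed_arity_le[of t] by (auto simp: child_def trim_conv_take)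

lemma lab_mform: "t \<in> PT \<Longrightarrow> lab (mform t) w = lab t w"
proof (induction w arbitrary: t)
  case (Cons i w)
  consider "i = 0" | "i \<in> {1..trimmed_arity t}" | "trimmed_arity t < i"
    by fastforce
  then show ?case
  proof cases
    case 2
    then show ?thesis using Cons by (simp add: child_mform child_PT)
  next
    case 3
    then have "child t i \<in> E" using beyond_trimmed Cons.prems by blast
    then have "lab (child t i) w = id"
      using E_iff_lab[OF child_PT[OF Cons.prems]] by blast
    then show ?thesis using 3 by (simp add: child_beyond arity_mform del: mform.sel)
  qed simp
qed simp

text \<open>The trimmed arity is the largest \<open>i\<close> such that child \<open>i\<close> is
  outside \<open>E\<close> or the label moves \<open>i\<close>, and \<open>0\<close> if there is
  none. Both properties can be read off \<open>lab\<close>.\<close>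

lemma trimmed_arity_cong:
  assumes "t \<in> PT" "u \<in> PT" "lab t = lab u"
  shows "trimmed_arity t = trimmed_arity u"
proof -
  have "trimmed_arity t \<le> trimmed_arity u" if tu: "t \<in> PT" "u \<in> PT" "lab t = lab u" for t u
  proof (rule ccontr)
    assume less: "\<not> ?thesis"
    then have *: "child u (trimmed_arity t) \<in> E \<and> label u (trimmed_arity t) = trimmed_arity t"
      using beyond_trimmed[OF tu(2)] by simp
    have "lab (child t i) w = lab (child u i) w" for i w
      using fun_cong[OF tu(3), of "i # w"] by simp
    then have "child t (trimmed_arity t) \<in> E"
      using * by (simp add: E_iff_lab child_PT tu)
    moreover have "label t = label u"
      using fun_cong[OF tu(3), of "[]"] by simp
    ultimately show False
      using at_trimmed[of t] * less by simp
  qed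
  from this[of t u] this[of u t] show ?thesis
    using assms by simp
qed

text \<open>Trimming removes only children that \<open>lab\<close> cannot tell from
  \<open>eps\<close>, so \<open>mform\<close> preserves \<open>lab\<close>. Conversely
  \<open>lab\<close> determines the arities of the normal form, and equality follows by
  coinduction.\<close>

theorem mform_eq_iff_lab:
  assumes "t \<in> PT" "u \<in> PT"
  shows "mform t = mform u \<longleftrightarrow> lab t = lab u"
proof
  assume "mform t = mform u"
  then have "lab t w = lab u w" for w
    using lab_mform assms by metis
  then show "lab t = lab u" ..
next
  let ?X = "\<lambda>s s'. \<exists>t u. s = mform t \<and> s' = mform u \<and> t \<in> PT \<and> u \<in> PT \<and> lab t = lab u"
  assume "lab t = lab u"
  then have "?X (mform t) (mform u)" using assms by blast
  then show "mform t = mform u"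
  proof (rule tree_coinduct_child)
    fix s s' assume "?X s s'"
    then obtain t u where s: "s = mform t" "s' = mform u" "t \<in> PT" "u \<in> PT" "lab t = lab u"
      by blast
    have len: "trimmed_arity t = trimmed_arity u"
      using trimmed_arity_cong s by blast
    have "lab (child t i) = lab (child u i)" for i
      using fun_cong[OF s(5), of "i # w" for w] by auto
    then have "?X (child s i) (child s' i)" if "i \<in> {1..arity s}" for i
      using that s len child_PT by (metis arity_mform child_mform)
    moreover have "label t = label u"
      using fun_cong[OF s(5), of "[]"] by simp
    ultimately show "label s = label s' \<and> arity s = arity s' \<and>
        (\<forall>i\<in>{1..arity s}. ?X (child s i) (child s' i))"
      using s len by (simp add: arity_mform del: mform.sel(2))
  qed
qed

section \<open>Products, inverses and the natural order\<close>

lemma arity_mult: "arity (t \<cdot> u) = max (arity t) (arity u)"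
  by (simp del: upt_Suc)

text \<open>Padding with \<open>eps\<close> merges the two cases of the product: beyond its arity,
  \<open>u\<close> has the child \<open>eps\<close> and its label fixes \<open>i\<close>. Note that
  the order of the factors is reversed at the children.\<close>

lemma child_mult:
  assumes "u \<in> PT"
  shows "child (t \<cdot> u) i = child u i \<cdot> child t (label u i)"
proof -
  consider "i = 0" | "i \<in> {1..arity u}" | "arity u < i" "i \<le> arity t" | "arity u < i" "arity t < i"
    by fastforce
  then show ?thesis
  proof cases
    case 1
    then show ?thesis using label_0[OF assms] by (simp add: pt_mult_eps)
  next
    case 2
    then have "i - 1 < max (arity t) (arity u)" "Suc (i - 1) = i" by auto
    then show ?thesis using 2 by (subst child_def) (simp del: upt_Suc)
  next
    case 3
    then have "i - 1 < max (arity t) (arity u)" "Suc (i - 1) = i" by auto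
    then show ?thesis
      using 3 label_beyond[OF assms] by (subst child_def) (simp add: eps_pt_mult child_beyond[of u] del: upt_Suc)
  next
    case 4
    then show ?thesis
      using label_beyond[OF assms] by (simp add: child_beyond pt_mult_eps del: pt_mult.sel)
         (simp add: child_beyond)
  qed
qed

lemma mult_PT: "t \<in> PT \<Longrightarrow> u \<in> PT \<Longrightarrow> t \<cdot> u \<in> PT"
proof (rule PT_coinduct_child[where X = "\<lambda>s. \<exists>t\<in>PT. \<exists>u\<in>PT. s = t \<cdot> u"])
  fix s assume "\<exists>t\<in>PT. \<exists>u\<in>PT. s = t \<cdot> u"
  then obtain t u where s: "t \<in> PT" "u \<in> PT" "s = t \<cdot> u" by blast
  have "label t permutes {1..arity s}" "label u permutes {1..arity s}"
    by (rule permutes_subset[OF PT_label[OF s(1)]] permutes_subset[OF PT_label[OF s(2)]],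
        simp add: s(3) arity_mult del: pt_mult.sel)+
  then have "label s permutes {1..arity s}"
    using permutes_compose s(3) by fastforce
  moreover have "\<exists>t\<in>PT. \<exists>u\<in>PT. child s i = t \<cdot> u" for i
    using s child_mult child_PT by blast
  ultimately show "label s permutes {1..arity s} \<and>
      (\<forall>i\<in>{1..arity s}. \<exists>t\<in>PT. \<exists>u\<in>PT. child s i = t \<cdot> u)" by blast
qed blast

lemma arity_star: "arity (pt_star t) = arity t"
  by (simp del: upt_Suc)

lemma star_eps: "pt_star eps = eps"
  by (rule tree.expand) (simp add: eps_def)

lemma child_star:
  assumes "t \<in> PT"
  shows "child (pt_star t) i = pt_star (child t (inv (label t) i))"
proof (cases "i \<in> {1..arity t}")
  case True
  then have "i - 1 < arity t" "Suc (i - 1) = i" by auto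
  then show ?thesis using True by (subst child_def) (simp del: upt_Suc)
next
  case False
  then have "inv (label t) i = i"
    using permutes_inv[OF PT_label[OF assms]] permutes_not_in by metis
  then show ?thesis using False by (auto simp: child_def star_eps)
qed

lemma star_PT: "t \<in> PT \<Longrightarrow> pt_star t \<in> PT"
proof (rule PT_coinduct_child[where X = "\<lambda>s. \<exists>t\<in>PT. s = pt_star t"])
  fix s assume "\<exists>t\<in>PT. s = pt_star t"
  then show "label s permutes {1..arity s} \<and> (\<forall>i\<in>{1..arity s}. \<exists>t\<in>PT. child s i = pt_star t)"
    using permutes_inv[OF PT_label] child_star child_PT
    by (auto simp del: pt_star.sel simp: arity_star pt_star.sel(1))
qed blast

lemma inv_label: "t \<in> PT \<Longrightarrow> inv (label t) (label t i) = i" "t \<in> PT \<Longrightarrow> label t (inv (label t) i) = i"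
  using permutes_inverses[OF PT_label] by metis+

lemma child_mult_star:
  assumes "t \<in> PT"
  shows "child (t \<cdot> pt_star t) i =
    pt_star (child t (inv (label t) i)) \<cdot> child t (inv (label t) i)"
  using assms by (simp add: child_mult star_PT child_star)

lemma child_star_mult:
  assumes "t \<in> PT"
  shows "child (pt_star t \<cdot> t) i = child t i \<cdot> pt_star (child t i)"
  using assms by (simp add: child_mult child_star inv_label)

text \<open>The two products need a joint induction: with \<open>s\<close> ranging over the children
  of \<open>t\<close>, the children of \<open>t \<cdot> pt_star t\<close> have the form
  \<open>pt_star s \<cdot> s\<close>, and those of \<open>pt_star t \<cdot> t\<close> the form
  \<open>s \<cdot> pt_star s\<close>.\<close>

lemma lab_mult_star: "t \<in> PT \<Longrightarrow> lab (t \<cdot> pt_star t) w = id \<and> lab (pt_star t \<cdot> t) w = id"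
proof (induction w arbitrary: t)
  case Nil
  then show ?case by (simp add: fun_eq_iff inv_label)
next
  case (Cons i w)
  then show ?case by (simp add: child_mult_star child_star_mult child_PT)
qed

text \<open>Both sides are treated at once because the order of the factors alternates from one
  level to the next.\<close>

lemma lab_mult_id:
  assumes "e \<in> PT" "v \<in> PT" "\<And>w. lab e w = id"
  shows "lab (e \<cdot> v) w = lab v w \<and> lab (v \<cdot> e) w = lab v w"
  using assms
proof (induction w arbitrary: e v)
  case Nil
  then show ?case using Nil(3)[of "[]"] by simp
next
  case (Cons i w)
  have "label e i = i" for i using Cons.prems(3)[of "[]"] by simp
  moreover have "lab (child e j) w = id" for j w
    using Cons.prems(3)[of "j # w"] by (simp add: id_def)
  ultimately show ?case using Cons by (simp add: child_mult child_PT)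
qed

lemma pt_le_imp_lab:
  assumes "u \<in> PT" "v \<in> PT" "pt_le u v"
  shows "lab u = lab v"
proof
  fix w
  have "lab (u \<cdot> pt_star u \<cdot> v) w = lab v w"
    using lab_mult_id[of "u \<cdot> pt_star u" v w] lab_mult_star assms by (simp add: mult_PT star_PT)
  then show "lab u w = lab v w"
    using assms(3) by (simp add: pt_le_def)
qed

text \<open>Natural order on trees with equal labels amounts to having at least as many children
  at every node.\<close>

coinductive dominates :: "ptree \<Rightarrow> ptree \<Rightarrow> bool" where
  "\<lbrakk>label w = label t; arity t \<le> arity w; \<And>i. dominates (child w i) (child t i)\<rbrakk> \<Longrightarrow> dominates w t"

lemma dominates_imp_pt_le:
  assumes "w \<in> PT" "t \<in> PT" "dominates w t"
  shows "pt_le w t"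
proof -
  \<comment> \<open>The second shape of \<open>s\<close> appears because passing to a child reverses
    the product: children of the first shape have the second one, and vice versa.\<close>
  let ?X = "\<lambda>s w. \<exists>t\<in>PT. w \<in> PT \<and> dominates w t \<and> (s = w \<cdot> pt_star w \<cdot> t \<or> s = t \<cdot> (pt_star w \<cdot> w))"
  have "?X (w \<cdot> pt_star w \<cdot> t) w" using assms by blast
  then have "w \<cdot> pt_star w \<cdot> t = w"
  proof (rule tree_coinduct_child[where X = ?X])
    fix s w assume "?X s w"
    then obtain t where t: "t \<in> PT" "w \<in> PT" "dominates w t"
      and s: "s = w \<cdot> pt_star w \<cdot> t \<or> s = t \<cdot> (pt_star w \<cdot> w)" by blast
    from t(3) have d: "label w = label t" "arity t \<le> arity w" "\<And>i. dominates (child w i) (child t i)"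
      by (auto elim: dominates.cases)
    have "label s = label w"
      using s d(1) t inv_label by (auto simp: fun_eq_iff)
    moreover have "arity s = arity w"
      using s d(2) by (auto simp del: pt_mult.sel pt_star.sel simp: arity_mult arity_star)
    moreover have "?X (child s i) (child w i)" for i
    proof -
      have "label (pt_star w \<cdot> w) = id"
        using t by (auto simp: fun_eq_iff inv_label)
      then have "child s i = child t i \<cdot> (pt_star (child w i) \<cdot> child w i) \<or>
          child s i = child w i \<cdot> pt_star (child w i) \<cdot> child t i"
        using s t d(1) inv_label(1)[OF t(1)]
        by (auto simp: child_mult mult_PT star_PT child_mult_star child_star_mult child_star)
      then show ?thesis using t d(3) child_PT by blast
    qed
    ultimately show "label s = label w \<and> arity s = arity w \<and> (\<forall>i\<in>{1..arity s}. ?X (child s i) (child w i))"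
      by blast
  qed
  then show ?thesis by (simp add: pt_le_def)
qed

text \<open>The union of two trees with equal \<open>lab\<close>. Taking the labels from
  \<open>t\<close> is an arbitrary choice that makes the function total.\<close>

primcorec join :: "ptree \<Rightarrow> ptree \<Rightarrow> ptree" where
  "join t u = Node (label t)
     (map (\<lambda>i. join (child t i) (child u i)) [1..<Suc (max (arity t) (arity u))])"

lemma join_eps: "join eps eps = eps"
  by (rule tree.expand) (simp add: eps_def)

lemma arity_join: "arity (join t u) = max (arity t) (arity u)"
  by (simp del: upt_Suc)

lemma child_join: "child (join t u) i = join (child t i) (child u i)"
proof (cases "i \<in> {1..max (arity t) (arity u)}")
  case True
  then have "i - 1 < max (arity t) (arity u)" "Suc (i - 1) = i" by auto
  then show ?thesis using True by (subst child_def) (simp del: upt_Suc)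
next
  case False
  then show ?thesis by (auto simp: child_def join_eps)
qed

lemma join_PT: "t \<in> PT \<Longrightarrow> u \<in> PT \<Longrightarrow> join t u \<in> PT"
proof (rule PT_coinduct_child[where X = "\<lambda>s. \<exists>t\<in>PT. \<exists>u\<in>PT. s = join t u"])
  fix s assume "\<exists>t\<in>PT. \<exists>u\<in>PT. s = join t u"
  then obtain t u where s: "t \<in> PT" "u \<in> PT" "s = join t u" by blast
  have "label s permutes {1..arity s}"
    using permutes_subset[OF PT_label[OF s(1)], of "{1..arity s}"] s(3)
    by (simp add: arity_join del: join.sel(2))
  moreover have "\<exists>t\<in>PT. \<exists>u\<in>PT. child s i = join t u" for i
    using s child_join child_PT by blast
  ultimately show "label s permutes {1..arity s} \<and>
      (\<forall>i\<in>{1..arity s}. \<exists>t\<in>PT. \<exists>u\<in>PT. child s i = join t u)" by blast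
qed blast

lemma dominates_join:
  assumes "lab t = lab u"
  shows "dominates (join t u) t" "dominates (join t u) u"
proof -
  have c: "label t = label u" "lab (child t i) = lab (child u i)" if "lab t = lab u" for t u i
    using fun_cong[OF that, of "[]"] fun_cong[OF that, of "i # w" for w] by auto
  show "dominates (join t u) t" using assms
  proof (coinduction arbitrary: t u)
    case (dominates t u)
    then show ?case
      using c(2)[OF dominates]
      by (intro exI[of _ "join t u"] exI[of _ t]) (auto simp: child_join arity_join simp del: join.sel(2))
  qed
  show "dominates (join t u) u" using assms
  proof (coinduction arbitrary: t u)
    case (dominates t u)
    then show ?case
      using c[OF dominates]
      by (intro exI[of _ "join t u"] exI[of _ u]) (auto simp: child_join arity_join simp del: join.sel(2))
  qed
qed

theorem sigma_PT_iff_lab: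
  assumes "t \<in> PT" "u \<in> PT"
  shows "sigma_PT t u \<longleftrightarrow> lab t = lab u"
proof
  assume "sigma_PT t u"
  then obtain w where "w \<in> PT" "pt_le w t" "pt_le w u"
    by (auto simp: sigma_PT_def)
  then show "lab t = lab u"
    using pt_le_imp_lab[of w t] pt_le_imp_lab[of w u] assms by simp
next
  assume "lab t = lab u"
  then have "pt_le (join t u) t" "pt_le (join t u) u"
    using assms dominates_join by (auto intro!: dominates_imp_pt_le join_PT)
  then show "sigma_PT t u"
    using join_PT[OF assms] by (auto simp: sigma_PT_def)
qed

section \<open>An extensional filter model\<close>

text \<open>Strict intersection types: the list to the left of an arrow is a finite intersection,
  and the empty list is the universal type.\<close>

datatype ty = Base | Arr "ty list" ty

text \<open>With \<open>Base\<close> read as \<open>Arr [] Base\<close>, every type unfolds into an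
  infinite sequence of arguments, almost all of them empty.\<close>

fun src :: "ty \<Rightarrow> ty list" where
  "src Base = []"
| "src (Arr s A) = s"

fun tgt :: "ty \<Rightarrow> ty" where
  "tgt Base = Base"
| "tgt (Arr s A) = A"

text \<open>Arguments are counted from \<open>1\<close>, like children. Index \<open>0\<close> gets
  no types, so that quantifying over all indices in \<open>rel\<close> adds no condition
  there.\<close>

definition arg :: "nat \<Rightarrow> ty \<Rightarrow> ty list" where
  "arg i A = (if i = 0 then [] else src ((tgt ^^ (i - 1)) A))"

lemma arg_0 [simp]: "arg 0 A = []"
  by (simp add: arg_def)

lemma arg_1 [simp]: "arg (Suc 0) A = src A"
  by (simp add: arg_def)

lemma arg_Suc_Suc: "arg (Suc (Suc i)) A = arg (Suc i) (tgt A)"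
  by (simp add: arg_def funpow_swap1)

lemma arg_tgt_pow: "0 < i \<Longrightarrow> arg i ((tgt ^^ n) A) = arg (i + n) A"
  by (auto simp: arg_def funpow_add[symmetric] simp flip: comp_apply[of "tgt ^^ _" "tgt ^^ _"])

lemma size_tgt_pow: "size ((tgt ^^ n) A) \<le> size A"
proof (induction n)
  case (Suc n)
  have "size (tgt B) \<le> size B" for B by (cases B) auto
  from this[of "(tgt ^^ n) A"] Suc show ?case by simp
qed simp

text \<open>The bound is on the whole list of argument types, because the induction for
  \<open>act_iff_rel\<close> measures a list of types together with a type.\<close>

lemma size_arg: "size_list size (arg i A) \<le> size A"
proof -
  have "size_list size (src B) \<le> size B" for B by (cases B) auto
  from this[of "(tgt ^^ (i - 1)) A"] size_tgt_pow[of "i - 1" A] show ?thesis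
    by (auto simp: arg_def)
qed

lemma size_in_list: "a \<in> set s \<Longrightarrow> size a < size_list size s" for a :: ty
  by (induction s) auto

lemma size_in_arg: "a \<in> set (arg i A) \<Longrightarrow> size a < size A"
  using size_in_list size_arg by (metis order_less_le_trans)

lemma arg_Base [simp]: "arg i Base = []"
proof -
  have "(tgt ^^ n) Base = Base" for n by (induction n) auto
  then show ?thesis by (simp add: arg_def)
qed

text \<open>\<open>rel (lab t) A B\<close> says that \<open>t\<^sup>+ x\<close> has type \<open>B\<close> if \<open>x\<close> has type \<open>A\<close>.  For \<open>t = eps\<close> this is
  subtyping, under which \<open>Base\<close> and \<open>Arr [] Base\<close> are equivalent.\<close>

inductive rel :: "(nat list \<Rightarrow> nat \<Rightarrow> nat) \<Rightarrow> ty \<Rightarrow> ty \<Rightarrow> bool" where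
  "(\<And>i a. a \<in> set (arg i A) \<Longrightarrow> \<exists>b\<in>set (arg (g [] i) B). rel (\<lambda>w. g (i # w)) b a) \<Longrightarrow> rel g A B"

abbreviation le :: "ty \<Rightarrow> ty \<Rightarrow> bool" where
  "le \<equiv> rel (\<lambda>_ i. i)"

lemma rel_iff: "rel g A B \<longleftrightarrow>
    (\<forall>i. \<forall>a\<in>set (arg i A). \<exists>b\<in>set (arg (g [] i) B). rel (\<lambda>w. g (i # w)) b a)"
  by (subst rel.simps) blast

lemma le_iff: "le A B \<longleftrightarrow> (\<forall>i. \<forall>a\<in>set (arg i A). \<exists>b\<in>set (arg i B). le b a)"
  by (subst rel_iff) simp

lemma le_refl [simp]: "le A A"
proof (induction "size A" arbitrary: A rule: less_induct)
  case less
  then show ?case using size_in_arg by (subst le_iff) blast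
qed

text \<open>Subtyping is contravariant in the arguments, so composition on the right for one level
  uses composition on the left for the next; the induction proves both. The variable
  \<open>g\<close> is there to allow rule induction on an instance of \<open>rel\<close>.\<close>

lemma le_trans_aux:
  assumes "rel g A B" "g = (\<lambda>_ i. i)"
  shows "(\<forall>C. le B C \<longrightarrow> le A C) \<and> (\<forall>C. le C A \<longrightarrow> le C B)"
  using assms
proof (induction rule: rel.induct)
  case (1 A g B)
  have *: "\<exists>b\<in>set (arg i B). (\<forall>C. le a C \<longrightarrow> le b C) \<and> (\<forall>C. le C b \<longrightarrow> le C a)"
    if a: "a \<in> set (arg i A)" for i a
  proof -
    obtain b where b: "b \<in> set (arg i B)" and
      IH: "(\<lambda>w. g (i # w)) = (\<lambda>_ i. i) \<Longrightarrow> (\<forall>C. le a C \<longrightarrow> le b C) \<and> (\<forall>C. le C b \<longrightarrow> le C a)"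
      using 1(1)[OF a] unfolding 1(2) by blast
    have "(\<lambda>w. g (i # w)) = (\<lambda>_ i. i)" unfolding 1(2) ..
    with b IH show ?thesis by blast
  qed
  show ?case
  proof (intro conjI allI impI)
    fix C assume "le B C"
    then show "le A C"
      using * by (subst le_iff) (subst (asm) le_iff, meson)
  next
    fix C assume "le C A"
    then show "le C B"
      using * by (subst le_iff) (subst (asm) le_iff, meson)
  qed
qed

lemma le_trans: "le A B \<Longrightarrow> le B C \<Longrightarrow> le A C"
  using le_trans_aux by blast

lemma le_arr_iff: "le A B \<longleftrightarrow> (\<forall>a\<in>set (src A). \<exists>b\<in>set (src B). le b a) \<and> le (tgt A) (tgt B)"
proof
  assume *: "le A B"
  show "(\<forall>a\<in>set (src A). \<exists>b\<in>set (src B). le b a) \<and> le (tgt A) (tgt B)"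
  proof
    show "\<forall>a\<in>set (src A). \<exists>b\<in>set (src B). le b a"
      using * by (subst (asm) le_iff) (metis arg_1)
    have "\<exists>b\<in>set (arg i (tgt B)). le b a" if "a \<in> set (arg i (tgt A))" for i a
      using * that by (subst (asm) le_iff) (cases i, simp, metis arg_Suc_Suc)
    then show "le (tgt A) (tgt B)" by (subst le_iff) blast
  qed
next
  assume *: "(\<forall>a\<in>set (src A). \<exists>b\<in>set (src B). le b a) \<and> le (tgt A) (tgt B)"
  have "\<exists>b\<in>set (arg i B). le b a" if a: "a \<in> set (arg i A)" for i a
  proof -
    consider "i = 0" | "i = Suc 0" | j where "i = Suc (Suc j)"
      by (metis not0_implies_Suc)
    then show ?thesis
    proof cases
      case 3
      have "\<forall>a\<in>set (arg (Suc j) (tgt A)). \<exists>b\<in>set (arg (Suc j) (tgt B)). le b a"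
        using * le_iff[of "tgt A" "tgt B"] by blast
      then show ?thesis using a 3 by (simp add: arg_Suc_Suc)
    qed (use a * in auto)
  qed
  then show "le A B" by (subst le_iff) blast
qed

lemma le_tgt_pow: "le A B \<Longrightarrow> le ((tgt ^^ n) A) ((tgt ^^ n) B)"
  by (induction n) (auto simp: le_arr_iff[of "(tgt ^^ _) A"])

lemma le_Base [simp]: "le Base A"
  by (subst le_iff) simp

lemma le_Arr_src_tgt: "le A (Arr (src A) (tgt A))"
  by (subst le_arr_iff) (auto intro: le_refl)

section \<open>Filters and the interpretation of terms\<close>

definition up :: "ty set \<Rightarrow> bool" where
  "up d \<longleftrightarrow> (\<forall>A\<in>d. \<forall>B. le A B \<longrightarrow> B \<in> d)"

text \<open>The filter generated by finitely many types. Closure under intersections does not arise,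
  since intersections occur only to the left of arrows.\<close>

definition upc :: "ty list \<Rightarrow> ty set" where
  "upc s = {B. \<exists>A\<in>set s. le A B}"

lemma upD: "up d \<Longrightarrow> A \<in> d \<Longrightarrow> le A B \<Longrightarrow> B \<in> d"
  by (auto simp: up_def)

lemma up_upc [simp]: "up (upc s)"
  by (auto simp: up_def upc_def intro: le_trans)

lemma upc_subset: "up d \<Longrightarrow> upc s \<subseteq> d \<longleftrightarrow> set s \<subseteq> d"
  by (auto simp: up_def upc_def intro: le_refl)

lemma upc_mono: "\<forall>a\<in>set s. \<exists>b\<in>set s'. le b a \<Longrightarrow> upc s \<subseteq> upc s'"
  by (auto simp: upc_def intro: le_trans)

lemma upc_Nil [simp]: "upc [] = {}"
  by (simp add: upc_def)

lemma upc_Base: "upc [Base] = UNIV"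
  by (simp add: upc_def)

lemma up_UNIV [simp]: "up UNIV"
  by (simp add: up_def)

definition app :: "ty set \<Rightarrow> ty set \<Rightarrow> ty set" where
  "app d e = {A. \<exists>s. Arr s A \<in> d \<and> set s \<subseteq> e}"

text \<open>The clause for abstraction uses \<open>src\<close> and \<open>tgt\<close> in order that
  \<open>Base\<close> and \<open>Arr [] Base\<close> lie in the same values, as upward closure
  demands.\<close>

primrec sem :: "trm \<Rightarrow> (nat \<Rightarrow> ty set) \<Rightarrow> ty set" where
  "sem (Var i) \<rho> = \<rho> i"
| "sem (App M N) \<rho> = app (sem M \<rho>) (sem N \<rho>)"
| "sem (Lam M) \<rho> = {A. tgt A \<in> sem M (case_nat (upc (src A)) \<rho>)}"

lemma app_mono: "d \<subseteq> d' \<Longrightarrow> e \<subseteq> e' \<Longrightarrow> app d e \<subseteq> app d' e'"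
  by (auto simp: app_def)

lemma up_app: "up d \<Longrightarrow> up (app d e)"
proof -
  assume d: "up d"
  have "Arr s B \<in> d" if "Arr s A \<in> d" "le A B" for s A B
    by (rule upD[OF d that(1)]) (use that(2) in \<open>subst le_arr_iff, auto intro: le_refl\<close>)
  then show ?thesis by (auto simp: up_def app_def)
qed

lemma sem_mono: "(\<And>i. \<rho> i \<subseteq> \<rho>' i) \<Longrightarrow> sem M \<rho> \<subseteq> sem M \<rho>'"
proof (induction M arbitrary: \<rho> \<rho>')
  case (App M N)
  then show ?case by (simp add: app_mono)
next
  case (Lam M)
  have "sem M (case_nat d \<rho>) \<subseteq> sem M (case_nat d \<rho>')" for d
    by (rule Lam.IH) (auto split: nat.split dest: subsetD[OF Lam.prems])
  then show ?case by auto
qed simp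

lemma up_sem: "(\<And>i. up (\<rho> i)) \<Longrightarrow> up (sem M \<rho>)"
proof (induction M arbitrary: \<rho>)
  case (App M N)
  then show ?case by (simp add: up_app)
next
  case (Lam M)
  have "tgt B \<in> sem M (case_nat (upc (src B)) \<rho>)"
    if A: "tgt A \<in> sem M (case_nat (upc (src A)) \<rho>)" and le: "le A B" for A B
  proof -
    from le have "upc (src A) \<subseteq> upc (src B)" "le (tgt A) (tgt B)"
      by (auto simp: le_arr_iff[of A B] intro!: upc_mono)
    then have "sem M (case_nat (upc (src A)) \<rho>) \<subseteq> sem M (case_nat (upc (src B)) \<rho>)"
      by (intro sem_mono) (auto split: nat.split)
    moreover have "up (sem M (case_nat (upc (src A)) \<rho>))"
      by (rule Lam.IH) (auto split: nat.split intro: Lam.prems)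
    ultimately show ?thesis
      using A \<open>le (tgt A) (tgt B)\<close> upD by blast
  qed
  then show ?case by (auto simp: up_def)
qed simp

lemma sem_ren: "sem (ren f M) \<rho> = sem M (\<rho> \<circ> f)"
proof (induction M arbitrary: f \<rho>)
  case (Lam M)
  have "case_nat d \<rho> \<circ> up_ren f = case_nat d (\<rho> \<circ> f)" for d
    by (rule ext) (auto simp: up_ren_def split: nat.split)
  then show ?case by (simp add: Lam del: comp_apply)
qed auto

lemma sem_subst: "sem (subst \<sigma> M) \<rho> = sem M (\<lambda>i. sem (\<sigma> i) \<rho>)"
proof (induction M arbitrary: \<sigma> \<rho>)
  case (Lam M)
  have "(\<lambda>i. sem (case i of 0 \<Rightarrow> Var 0 | Suc i \<Rightarrow> ren Suc (\<sigma> i)) (case_nat d \<rho>)) =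
      case_nat d (\<lambda>i. sem (\<sigma> i) \<rho>)" for d
    by (rule ext) (auto simp: sem_ren comp_def split: nat.split)
  then show ?case by (simp add: Lam)
qed auto

text \<open>A typing uses only finitely many types of each variable.\<close>

lemma sem_continuous: "A \<in> sem M \<rho> \<Longrightarrow> up (\<rho> k) \<Longrightarrow> \<exists>s. set s \<subseteq> \<rho> k \<and> A \<in> sem M (\<rho>(k := upc s))"
proof (induction M arbitrary: A \<rho> k)
  case (Var i)
  then show ?case
    by (cases "i = k") (auto simp: upc_def intro: exI[of _ "[A]"] exI[of _ "[]"])
next
  case (App M N)
  from App.prems(1) obtain s where s: "Arr s A \<in> sem M \<rho>" "set s \<subseteq> sem N \<rho>"
    by (auto simp: app_def)
  obtain s0 where s0: "set s0 \<subseteq> \<rho> k" "Arr s A \<in> sem M (\<rho>(k := upc s0))"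
    using App.IH(1)[OF s(1) App.prems(2)] by blast
  have mono: "sem P (\<rho>(k := upc s)) \<subseteq> sem P (\<rho>(k := upc s'))" if "set s \<subseteq> set s'" for s s' P
    by (rule sem_mono) (use that in \<open>auto simp: upc_def\<close>)
  \<comment> \<open>The argument is typed once for each of the finitely many types in
    \<open>s\<close>; appending the lists obtained gives one list that serves all of them.\<close>
  have "\<exists>s1. set s1 \<subseteq> \<rho> k \<and> set s \<subseteq> sem N (\<rho>(k := upc s1))"
    using s(2)
  proof (induction s)
    case (Cons a s)
    then obtain s1 where s1: "set s1 \<subseteq> \<rho> k" "set s \<subseteq> sem N (\<rho>(k := upc s1))"
      by (auto simp del: fun_upd_apply)
    obtain s2 where s2: "set s2 \<subseteq> \<rho> k" "a \<in> sem N (\<rho>(k := upc s2))"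
      using App.IH(2)[of a \<rho> k] App.prems(2) Cons.prems
      by (auto simp del: fun_upd_apply)
    have "sem N (\<rho>(k := upc s1)) \<subseteq> sem N (\<rho>(k := upc (s1 @ s2)))"
      "sem N (\<rho>(k := upc s2)) \<subseteq> sem N (\<rho>(k := upc (s1 @ s2)))"
      by (rule mono, simp)+
    then have "set (a # s) \<subseteq> sem N (\<rho>(k := upc (s1 @ s2)))"
      using s1(2) s2(2) by (auto simp del: fun_upd_apply)
    then show ?case
      using s1(1) s2(1) by (intro exI[of _ "s1 @ s2"]) (auto simp del: fun_upd_apply)
  qed (auto intro: exI[of _ "[]"])
  then obtain s1 where s1: "set s1 \<subseteq> \<rho> k" "set s \<subseteq> sem N (\<rho>(k := upc s1))"
    by blast
  have "Arr s A \<in> sem M (\<rho>(k := upc (s0 @ s1)))" "set s \<subseteq> sem N (\<rho>(k := upc (s0 @ s1)))"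
    using mono[of s0 "s0 @ s1" M] mono[of s1 "s0 @ s1" N] s0(2) s1(2) by auto
  then show ?case
    using s0(1) s1(1) unfolding app_def sem.simps
    by (intro exI[of _ "s0 @ s1"]) (auto simp del: fun_upd_apply)
next
  case (Lam M)
  have "(case_nat d \<rho>)(Suc k := e) = case_nat d (\<rho>(k := e))" for d e
    by (rule ext) (auto split: nat.split)
  then show ?case
    using Lam.IH[of "tgt A" "case_nat (upc (src A)) \<rho>" "Suc k"] Lam.prems
    by (auto simp del: fun_upd_apply)
qed

text \<open>The abstraction clause only sees finitely generated arguments. Monotonicity gives one
  inclusion and continuity the other.\<close>

lemma app_Lam:
  assumes "up d"
  shows "app (sem (Lam M) \<rho>) d = sem M (case_nat d \<rho>)"
proof
  show "app (sem (Lam M) \<rho>) d \<subseteq> sem M (case_nat d \<rho>)"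
  proof
    fix A assume "A \<in> app (sem (Lam M) \<rho>) d"
    then obtain s where s: "A \<in> sem M (case_nat (upc s) \<rho>)" "set s \<subseteq> d"
      by (auto simp: app_def)
    have "sem M (case_nat (upc s) \<rho>) \<subseteq> sem M (case_nat d \<rho>)"
      by (rule sem_mono) (use s(2) upc_subset[OF assms] in \<open>auto split: nat.splits\<close>)
    with s(1) show "A \<in> sem M (case_nat d \<rho>)" by blast
  qed
  show "sem M (case_nat d \<rho>) \<subseteq> app (sem (Lam M) \<rho>) d"
  proof
    fix A assume "A \<in> sem M (case_nat d \<rho>)"
    then obtain s where s: "set s \<subseteq> d" "A \<in> sem M ((case_nat d \<rho>)(0 := upc s))"
      using sem_continuous[of A M "case_nat d \<rho>" 0] assms by auto
    moreover have "(case_nat d \<rho>)(0 := upc s) = case_nat (upc s) \<rho>"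
      by (rule ext) (auto split: nat.split)
    ultimately show "A \<in> app (sem (Lam M) \<rho>) d" by (auto simp: app_def)
  qed
qed

text \<open>Extensionality: \<open>A\<close> and \<open>Arr (src A) (tgt A)\<close> are equivalent
  under \<open>le\<close>, so a filter is determined by its action on finitely generated
  filters.\<close>

lemma app_eta:
  assumes "up d"
  shows "A \<in> d \<longleftrightarrow> tgt A \<in> app d (upc (src A))"
proof
  assume "A \<in> d"
  then have "Arr (src A) (tgt A) \<in> d"
    using assms le_Arr_src_tgt upD by blast
  then show "tgt A \<in> app d (upc (src A))"
    by (auto simp: app_def upc_def intro!: exI[of _ "src A"] intro: le_refl)
next
  assume "tgt A \<in> app d (upc (src A))"
  then obtain s where s: "Arr s (tgt A) \<in> d" "set s \<subseteq> upc (src A)"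
    by (auto simp: app_def)
  have "le (Arr s (tgt A)) A"
    by (subst le_arr_iff) (use s(2) in \<open>auto simp: upc_def\<close>)
  then show "A \<in> d" using s(1) assms upD by blast
qed

lemma beta_sem: "beta M N \<Longrightarrow> (\<And>i. up (\<rho> i)) \<Longrightarrow> sem M \<rho> = sem N \<rho>"
proof (induction arbitrary: \<rho> rule: beta.induct)
  case (1 s t)
  have "(\<lambda>i. sem (case_nat t Var i) \<rho>) = case_nat (sem t \<rho>) \<rho>"
    by (rule ext) (auto split: nat.split)
  then have "sem (contract s t) \<rho> = sem s (case_nat (sem t \<rho>) \<rho>)"
    by (simp add: contract_def sem_subst)
  then show ?case
    using app_Lam[OF up_sem[of \<rho> t]] 1 by simp
next
  case (4 s s')
  have "sem s (case_nat (upc d) \<rho>) = sem s' (case_nat (upc d) \<rho>)" for d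
    by (rule 4(2)) (auto split: nat.split intro: 4(3))
  then show ?case by simp
qed auto

lemma betas_sem: "beta\<^sup>*\<^sup>* M N \<Longrightarrow> (\<And>i. up (\<rho> i)) \<Longrightarrow> sem M \<rho> = sem N \<rho>"
  by (induction rule: rtranclp_induct) (auto simp: beta_sem)

section \<open>Adequacy\<close>

text \<open>Like \<open>has_hnf\<close>, but by head reduction. That \<open>has_hnf\<close> implies
  \<open>hn\<close> is obtained from the model, which plays the part of a standardization
  theorem.\<close>

definition hn :: "trm \<Rightarrow> bool" where
  "hn M \<longleftrightarrow> (\<exists>N. head_red\<^sup>*\<^sup>* M N \<and> is_hnf N)"

lemma lams_Suc: "lams (Suc n) M = Lam (lams n M)"
  by simp

lemma beta_lams: "beta M N \<Longrightarrow> beta (lams n M) (lams n N)"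
  by (induction n) (auto intro: beta.intros)

lemma beta_apps: "beta M N \<Longrightarrow> beta (apps M Ms) (apps N Ms)"
  by (induction Ms arbitrary: M N) (auto intro: beta.intros)

lemma head_red_imp_beta: "head_red M N \<Longrightarrow> beta M N"
  by (induction rule: head_red.induct) (intro beta_lams beta_apps beta.intros)

lemma head_reds_imp_betas: "head_red\<^sup>*\<^sup>* M N \<Longrightarrow> beta\<^sup>*\<^sup>* M N"
  by (induction rule: rtranclp_induct) (auto intro: rtranclp.rtrancl_into_rtrancl head_red_imp_beta)

lemma hn_imp_has_hnf: "hn M \<Longrightarrow> has_hnf M"
  by (auto simp: hn_def has_hnf_def dest: head_reds_imp_betas)

lemma hn_apps_Var: "hn (apps (Var x) Ms)"
  unfolding hn_def is_hnf_def
  by (intro exI[of _ "apps (Var x) Ms"] conjI rtranclp.rtrancl_refl exI[of _ "0::nat"] exI[of _ x] exI[of _ Ms]) simp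

lemma hn_expand: "hn (apps (contract P Q) Ms) \<Longrightarrow> hn (apps (App (Lam P) Q) Ms)"
  using head_red.intros[of 0 P Q Ms] by (auto simp: hn_def intro: converse_rtranclp_into_rtranclp)

lemma hn_Lam:
  assumes "hn M"
  shows "hn (Lam M)"
proof -
  have step: "head_red (Lam M) (Lam N)" if "head_red M N" for M N
    using that
  proof cases
    case (1 n P Q Ms)
    then show ?thesis using head_red.intros[of "Suc n" P Q Ms] by simp
  qed
  have "head_red\<^sup>*\<^sup>* (Lam M) (Lam N)" if "head_red\<^sup>*\<^sup>* M N" for N
    using that by (induction rule: rtranclp_induct) (auto intro: rtranclp.rtrancl_into_rtrancl step)
  moreover have "is_hnf (Lam N)" if "is_hnf N" for N
    using that unfolding is_hnf_def by (metis lams_Suc)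
  ultimately show ?thesis
    using assms by (auto simp: hn_def)
qed

section \<open>Renaming and substitution\<close>

lemma up_ren_comp: "up_ren f \<circ> up_ren g = up_ren (f \<circ> g)"
  by (rule ext) (simp add: up_ren_def split: nat.split)

lemma ren_ren: "ren f (ren g M) = ren (f \<circ> g) M"
  by (induction M arbitrary: f g) (auto simp: up_ren_comp)

lemma subst_ren: "subst \<sigma> (ren f M) = subst (\<sigma> \<circ> f) M"
proof (induction M arbitrary: \<sigma> f)
  case (Lam M)
  have "case_nat (Var 0) (\<lambda>i. ren Suc (\<sigma> i)) \<circ> up_ren f = case_nat (Var 0) (\<lambda>i. ren Suc ((\<sigma> \<circ> f) i))"
    by (rule ext) (simp add: up_ren_def split: nat.split)
  then show ?case by (simp add: Lam del: comp_apply)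
qed auto

lemma ren_subst: "ren f (subst \<sigma> M) = subst (\<lambda>i. ren f (\<sigma> i)) M"
proof (induction M arbitrary: \<sigma> f)
  case (Lam M)
  have "(\<lambda>i. ren (up_ren f) (case i of 0 \<Rightarrow> Var 0 | Suc i \<Rightarrow> ren Suc (\<sigma> i))) =
      case_nat (Var 0) (\<lambda>i. ren Suc (ren f (\<sigma> i)))"
    by (rule ext) (simp add: ren_ren up_ren_def comp_def split: nat.split)
  then show ?case by (simp add: Lam)
qed auto

lemma subst_subst: "subst \<tau> (subst \<sigma> M) = subst (\<lambda>i. subst \<tau> (\<sigma> i)) M"
proof (induction M arbitrary: \<sigma> \<tau>)
  case (Lam M)
  have "(\<lambda>i. subst (case_nat (Var 0) (\<lambda>i. ren Suc (\<tau> i))) (case i of 0 \<Rightarrow> Var 0 | Suc i \<Rightarrow> ren Suc (\<sigma> i))) =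
      case_nat (Var 0) (\<lambda>i. ren Suc (subst \<tau> (\<sigma> i)))"
    by (rule ext) (simp add: subst_ren ren_subst comp_def split: nat.split)
  then show ?case by (simp add: Lam)
qed auto

lemma subst_Var: "subst Var M = M"
proof (induction M)
  case (Lam M)
  have "case_nat (Var 0) (\<lambda>i. ren Suc (Var i)) = Var"
    by (rule ext) (simp split: nat.split)
  then show ?case by (simp add: Lam)
qed auto

lemma ren_id: "ren id M = M"
proof -
  have "up_ren id = id"
    by (rule ext) (simp add: up_ren_def split: nat.split)
  then show ?thesis by (induction M) auto
qed

lemma contract_subst:
  "contract (subst (case_nat (Var 0) (\<lambda>i. ren Suc (\<sigma> i))) P) N = subst (case_nat N \<sigma>) P"
proof -
  have "(\<lambda>i. subst (case_nat N Var) (case i of 0 \<Rightarrow> Var 0 | Suc i \<Rightarrow> ren Suc (\<sigma> i))) = case_nat N \<sigma>"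
    by (rule ext) (simp add: subst_ren comp_def subst_Var split: nat.split)
  then show ?thesis by (simp add: contract_def subst_subst)
qed

section \<open>Reducibility\<close>

text \<open>The quantification over renamings (as in a Kripke logical relation) makes \<open>val A\<close> closed
  under weakening, which is needed to go under a binder.\<close>

function val :: "ty \<Rightarrow> trm \<Rightarrow> bool" where
  "val A M \<longleftrightarrow> (\<forall>f Ns. (\<forall>i < length Ns. \<forall>a. a \<in> set (arg (Suc i) A) \<longrightarrow> val a (Ns ! i)) \<longrightarrow>
     hn (apps (ren f M) Ns))"
  by auto
termination
  by (relation "measure (\<lambda>(A, M). size A)") (auto simp: size_in_arg)

declare val.simps [simp del]

lemma valD:
  "val A M \<Longrightarrow> (\<And>i a. i < length Ns \<Longrightarrow> a \<in> set (arg (Suc i) A) \<Longrightarrow> val a (Ns ! i)) \<Longrightarrow> hn (apps (ren f M) Ns)"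
  by (subst (asm) val.simps) blast

lemma val_hn: "val A M \<Longrightarrow> hn M"
  using valD[of A M "[]" id] by (simp add: ren_id)

lemma val_ren: "val A M \<Longrightarrow> val A (ren f M)"
  by (subst val.simps) (auto simp: ren_ren intro: valD)

lemma val_Var: "val A (Var x)"
  by (subst val.simps) (auto intro: hn_apps_Var)

text \<open>Contravariance exchanges the two types at the arguments, hence the induction on the sum
  of their sizes.\<close>

lemma val_mono:
  assumes "le A B" "val A M"
  shows "val B M"
  using assms
proof (induction "size A + size B" arbitrary: A B M rule: less_induct)
  case less
  show ?case
  proof (subst val.simps, intro allI impI)
    fix f Ns assume Ns: "\<forall>i < length Ns. \<forall>a. a \<in> set (arg (Suc i) B) \<longrightarrow> val a (Ns ! i)"
    show "hn (apps (ren f M) Ns)"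
    proof (rule valD[OF less.prems(2)])
      fix i a assume i: "i < length Ns" "a \<in> set (arg (Suc i) A)"
      then obtain b where b: "b \<in> set (arg (Suc i) B)" "le b a"
        using less.prems(1) by (subst (asm) le_iff) blast
      moreover have "size b + size a < size A + size B"
        using size_in_arg[OF i(2)] size_in_arg[OF b(1)] by simp
      ultimately show "val a (Ns ! i)"
        using less.hyps[of b a "Ns ! i"] Ns i(1) by blast
    qed
  qed
qed

text \<open>Reducibility by induction on the term. An abstraction without arguments is entered with
  its bound variable, which lies in every \<open>val\<close>; with arguments, one head expansion
  reduces the claim to the body.\<close>

theorem fundamental:
  assumes "A \<in> sem M \<rho>" "\<And>i B. B \<in> \<rho> i \<Longrightarrow> val B (\<sigma> i)"
  shows "val A (subst \<sigma> M)"
  using assms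
proof (induction M arbitrary: A \<rho> \<sigma>)
  case (App M N)
  from App.prems(1) obtain s where s: "Arr s A \<in> sem M \<rho>" "set s \<subseteq> sem N \<rho>"
    by (auto simp: app_def)
  have M: "val (Arr s A) (subst \<sigma> M)"
    using App.IH(1)[OF s(1)] App.prems(2) by blast
  have N: "val a (subst \<sigma> N)" if "a \<in> set s" for a
    using App.IH(2) App.prems(2) that s(2) by blast
  show ?case
  proof (subst val.simps, intro allI impI)
    fix f Ns assume Ns: "\<forall>i < length Ns. \<forall>a. a \<in> set (arg (Suc i) A) \<longrightarrow> val a (Ns ! i)"
    have "hn (apps (ren f (subst \<sigma> M)) (ren f (subst \<sigma> N) # Ns))"
    proof (rule valD[OF M])
      fix i a assume "i < length (ren f (subst \<sigma> N) # Ns)" "a \<in> set (arg (Suc i) (Arr s A))"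
      then show "val a ((ren f (subst \<sigma> N) # Ns) ! i)"
        using Ns N by (cases i) (auto simp: arg_Suc_Suc intro: val_ren)
    qed
    then show "hn (apps (ren f (subst \<sigma> (App M N))) Ns)" by simp
  qed
next
  case (Lam M)
  have body: "val (tgt A) (subst (case_nat N \<tau>) M)"
    if N: "\<And>a. a \<in> set (src A) \<Longrightarrow> val a N" and \<tau>: "\<And>i B. B \<in> \<rho> i \<Longrightarrow> val B (\<tau> i)" for N \<tau>
  proof (rule Lam.IH)
    show "tgt A \<in> sem M (case_nat (upc (src A)) \<rho>)" using Lam.prems(1) by simp
    fix i B assume "B \<in> (case i of 0 \<Rightarrow> upc (src A) | Suc i \<Rightarrow> \<rho> i)"
    then show "val B (case i of 0 \<Rightarrow> N | Suc i \<Rightarrow> \<tau> i)"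
      using N \<tau> by (auto simp: upc_def intro: val_mono split: nat.splits)
  qed
  show ?case
  proof (subst val.simps, intro allI impI)
    fix f Ns assume Ns: "\<forall>i < length Ns. \<forall>a. a \<in> set (arg (Suc i) A) \<longrightarrow> val a (Ns ! i)"
    have *: "ren f (subst \<sigma> (Lam M)) = Lam (subst (case_nat (Var 0) (\<lambda>i. ren Suc (ren f (\<sigma> i)))) M)"
      by (subst ren_subst) simp
    show "hn (apps (ren f (subst \<sigma> (Lam M))) Ns)"
    proof (cases Ns)
      case Nil
      have "hn (subst (case_nat (Var 0) (\<lambda>i. ren Suc (ren f (\<sigma> i)))) M)"
        by (rule val_hn[OF body]) (auto intro: val_Var val_ren Lam.prems(2))
      then show ?thesis by (simp only: Nil * foldl.simps hn_Lam)
    next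
      case (Cons N Ns')
      have "val (tgt A) (subst (case_nat N (\<lambda>i. ren f (\<sigma> i))) M)"
        by (rule body) (use Ns Cons in \<open>auto intro: val_ren Lam.prems(2)\<close>)
      moreover have "val a (Ns' ! i)" if "i < length Ns'" "a \<in> set (arg (Suc i) (tgt A))" for i a
        using Ns[rule_format, of "Suc i" a] that Cons by (simp add: arg_Suc_Suc)
      ultimately have "hn (apps (subst (case_nat N (\<lambda>i. ren f (\<sigma> i))) M) Ns')"
        using valD[where f = id] by (metis ren_id)
      then have "hn (apps (contract (subst (case_nat (Var 0) (\<lambda>i. ren Suc (ren f (\<sigma> i)))) M) N) Ns')"
        by (simp only: contract_subst)
      from hn_expand[OF this] show ?thesis
        by (simp only: Cons * foldl.simps)
    qed
  qed
qed auto

lemma sem_imp_hn: "A \<in> sem M \<rho> \<Longrightarrow> hn M"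
  using fundamental[of A M \<rho> Var] val_Var by (auto simp: subst_Var intro: val_hn)

abbreviation top_env :: "nat \<Rightarrow> ty set" where
  "top_env \<equiv> \<lambda>_. UNIV"

lemma app_Base: "Base \<in> d \<Longrightarrow> up d \<Longrightarrow> Base \<in> app d e"
proof -
  assume "Base \<in> d" "up d"
  moreover have "le Base (Arr [] Base)" by simp
  ultimately have "Arr [] Base \<in> d" using upD by blast
  then show ?thesis by (auto simp: app_def intro: exI[of _ "[]"])
qed

text \<open>\<open>Base\<close> is a type of the head variable, and applications keep it because
  \<open>Base\<close> lies below \<open>Arr [] Base\<close>.\<close>

lemma sem_hnf_nonempty:
  assumes "is_hnf M"
  shows "sem M top_env \<noteq> {}"
proof -
  obtain n x Ms where M: "M = lams n (apps (Var x) Ms)"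
    using assms by (auto simp: is_hnf_def)
  have apps: "Base \<in> sem (apps N Ms) \<rho>" if "Base \<in> sem N \<rho>" "\<And>i. up (\<rho> i)" for N \<rho>
    using that(1)
  proof (induction Ms arbitrary: N)
    case (Cons K Ms)
    then show ?case using app_Base up_sem[OF that(2)] by simp
  qed simp
  have "\<exists>A. A \<in> sem (lams n (apps (Var x) Ms)) \<rho>"
    if "\<And>i. up (\<rho> i)" "\<And>i. Base \<in> \<rho> i" for \<rho>
    using that
  proof (induction n arbitrary: \<rho>)
    case 0
    then show ?case using apps[of "Var x" \<rho>] by auto
  next
    case (Suc n)
    \<comment> \<open>\<open>Base\<close> is the least type, so \<open>upc [Base]\<close> contains
      all types and the extended environment still has \<open>Base\<close> everywhere.\<close>
    have "\<exists>A. A \<in> sem (lams n (apps (Var x) Ms)) (case_nat (upc [Base]) \<rho>)"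
      by (rule Suc.IH) (auto split: nat.split simp: Suc.prems upc_Base)
    then obtain A where "A \<in> sem (lams n (apps (Var x) Ms)) (case_nat (upc [Base]) \<rho>)" ..
    then show ?case by (intro exI[of _ "Arr [Base] A"]) simp
  qed
  from this[of top_env] show ?thesis unfolding M by auto
qed

theorem has_hnf_iff_sem: "has_hnf M \<longleftrightarrow> sem M top_env \<noteq> {}"
proof
  assume "has_hnf M"
  then obtain N where N: "beta\<^sup>*\<^sup>* M N" "is_hnf N"
    by (auto simp: has_hnf_def)
  then show "sem M top_env \<noteq> {}"
    using betas_sem[OF N(1)] sem_hnf_nonempty[OF N(2)] by simp
next
  assume "sem M top_env \<noteq> {}"
  then show "has_hnf M"
    using sem_imp_hn hn_imp_has_hnf by blast
qed

text \<open>The nonempty value turns an arbitrary reduction to a head normal form into a terminating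
  head reduction, so the choice in \<open>phnf\<close> has a witness.\<close>

lemma has_hnf_imp_phnf:
  assumes "has_hnf M"
  shows "head_red\<^sup>*\<^sup>* M (lams (fst (phnf M)) (apps (Var (fst (snd (phnf M)))) (snd (snd (phnf M)))))"
proof -
  obtain N where N: "head_red\<^sup>*\<^sup>* M N" "is_hnf N"
    using assms sem_imp_hn unfolding has_hnf_iff_sem hn_def by blast
  then obtain n x Ms where "N = lams n (apps (Var x) Ms)"
    by (auto simp: is_hnf_def)
  then have "\<exists>p. (\<lambda>(n, x, Ms). head_red\<^sup>*\<^sup>* M (lams n (apps (Var x) Ms))) p"
    using N(1) by (intro exI[of _ "(n, x, Ms)"]) simp
  from someI_ex[OF this] show ?thesis
    unfolding phnf_def split_beta .
qed

lemma BT_Hnf: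
  assumes "BT M = Hnf n x Ts"
  obtains Ms where "head_red\<^sup>*\<^sup>* M (lams n (apps (Var x) Ms))" "Ts = map BT Ms"
proof -
  have "has_hnf M" "fst (phnf M) = n" "fst (snd (phnf M)) = x" "map BT (snd (snd (phnf M))) = Ts"
    using assms by (subst (asm) BT.code, auto split: if_splits)+
  then show thesis using that has_hnf_imp_phnf by blast
qed

section \<open>Contexts and the unsolvable term\<close>

lemma sem_fill:
  assumes "\<And>\<rho>. (\<And>i. up (\<rho> i)) \<Longrightarrow> sem M \<rho> = sem N \<rho>"
  shows "(\<And>i. up (\<rho> i)) \<Longrightarrow> sem (fill C M) \<rho> = sem (fill C N) \<rho>"
proof (induction C arbitrary: \<rho>)
  case (CLam C)
  have "sem (fill C M) (case_nat (upc s) \<rho>) = sem (fill C N) (case_nat (upc s) \<rho>)" for s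
    by (rule CLam.IH) (auto split: nat.split intro: CLam.prems)
  then show ?case by simp
qed (auto simp: assms)

lemma sem_eq_imp_H_star:
  assumes "\<And>\<rho>. (\<And>i. up (\<rho> i)) \<Longrightarrow> sem M \<rho> = sem N \<rho>"
  shows "H_star M N"
  using sem_fill[OF assms, of top_env] by (simp add: H_star_def has_hnf_iff_sem)

primrec ctxt_of :: "trm \<Rightarrow> ctxt" where
  "ctxt_of (Var i) = CVar i"
| "ctxt_of (App M N) = CApp (ctxt_of M) (ctxt_of N)"
| "ctxt_of (Lam M) = CLam (ctxt_of M)"

lemma fill_ctxt_of [simp]: "fill (ctxt_of M) N = M"
  by (induction M) auto

lemma H_star_apps:
  assumes "H_star M N"
  shows "has_hnf (apps M Ms) \<longleftrightarrow> has_hnf (apps N Ms)"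
proof -
  have "fill (foldl CApp C (map ctxt_of Ms)) M = apps (fill C M) Ms" for C M
    by (induction Ms arbitrary: C) auto
  from this[of Hole] show ?thesis
    using assms unfolding H_star_def by (metis fill.simps(1))
qed

definition omega :: trm where
  "omega = App (Lam (App (Var 0) (Var 0))) (Lam (App (Var 0) (Var 0)))"

lemma sem_omega: "sem omega top_env = {}"
proof -
  have step: "N = omega" if "beta omega N" for N
    using that unfolding omega_def
    by (auto elim!: beta.cases simp: contract_def)
  have "N = omega" if "beta\<^sup>*\<^sup>* omega N" for N
    using that by (induction rule: rtranclp_induct) (auto dest: step)
  moreover have "\<not> is_hnf omega"
  proof
    assume "is_hnf omega"
    then obtain n x Ms where *: "omega = lams n (apps (Var x) Ms)"
      by (auto simp: is_hnf_def)
    then show False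
      by (cases n; cases Ms rule: rev_cases; cases "butlast Ms" rule: rev_cases) (auto simp: omega_def)
  qed
  ultimately have "\<not> has_hnf omega"
    by (auto simp: has_hnf_def)
  then show ?thesis by (simp add: has_hnf_iff_sem)
qed

section \<open>The action of permutation trees\<close>

abbreviation apps_sem :: "ty set \<Rightarrow> ty set list \<Rightarrow> ty set" where
  "apps_sem d ds \<equiv> foldl app d ds"

lemma up_apps_sem: "up d \<Longrightarrow> up (apps_sem d ds)"
  by (induction ds arbitrary: d) (auto intro: up_app)

lemma sem_apps: "sem (apps M Ms) \<rho> = apps_sem (sem M \<rho>) (map (\<lambda>N. sem N \<rho>) Ms)"
  by (induction Ms arbitrary: M) auto

text \<open>The environment below \<open>length ds\<close> binders that have received the arguments
  \<open>ds\<close>; the last argument belongs to the innermost binder and has index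
  \<open>0\<close>.\<close>

definition push :: "ty set list \<Rightarrow> (nat \<Rightarrow> ty set) \<Rightarrow> nat \<Rightarrow> ty set" where
  "push ds \<rho> i = (if i < length ds then ds ! (length ds - Suc i) else \<rho> (i - length ds))"

lemma up_push: "\<forall>d\<in>set ds. up d \<Longrightarrow> (\<And>i. up (\<rho> i)) \<Longrightarrow> up (push ds \<rho> i)"
  by (auto simp: push_def)

lemma push_Cons: "push ds (case_nat d \<rho>) = push (d # ds) \<rho>"
proof
  fix i
  show "push ds (case_nat d \<rho>) i = push (d # ds) \<rho> i"
  proof (cases "i < length ds")
    case True
    then have "length ds - i = Suc (length ds - Suc i)" by simp
    with True show ?thesis by (simp add: push_def)
  next
    case False
    then obtain k where "i = length ds + k" by (metis le_iff_add not_less)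
    then show ?thesis by (cases k) (auto simp: push_def)
  qed
qed

lemma apps_sem_lams:
  assumes "\<forall>d\<in>set ds. up d"
  shows "apps_sem (sem (lams (length ds) M) \<rho>) ds = sem M (push ds \<rho>)"
  using assms
proof (induction ds arbitrary: \<rho>)
  case Nil
  have "push [] \<rho> = \<rho>" by (auto simp: push_def)
  then show ?case by simp
next
  case (Cons d ds)
  have "app (sem (Lam (lams (length ds) M)) \<rho>) d = sem (lams (length ds) M) (case_nat d \<rho>)"
    by (rule app_Lam) (use Cons.prems in simp)
  then show ?case
    using Cons by (simp add: push_Cons del: sem.simps(3))
qed

text \<open>A single type \<open>C\<close> of the function accounts for the whole chain of
  applications, since upward closure allows replacing \<open>C\<close> by
  \<open>Arr (src C) (tgt C)\<close> at each step.\<close>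

lemma apps_sem_iff:
  assumes "up d"
  shows "B \<in> apps_sem d ds \<longleftrightarrow>
    (\<exists>C\<in>d. le ((tgt ^^ length ds) C) B \<and> (\<forall>i<length ds. set (arg (Suc i) C) \<subseteq> ds ! i))"
  using assms
proof (induction ds arbitrary: d)
  case Nil
  have "B \<in> d" if "C \<in> d" "le C B" for C
    by (rule upD[OF Nil that])
  then show ?case by (auto intro: bexI[of _ B])
next
  case (Cons e ds)
  let ?P = "\<lambda>C. le ((tgt ^^ length ds) C) B \<and> (\<forall>i<length ds. set (arg (Suc i) C) \<subseteq> ds ! i)"
  let ?Q = "\<lambda>C. le ((tgt ^^ length (e # ds)) C) B \<and>
    (\<forall>i<length (e # ds). set (arg (Suc i) C) \<subseteq> (e # ds) ! i)"
  have Q: "?Q C \<longleftrightarrow> ?P (tgt C) \<and> set (src C) \<subseteq> e" for C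
    by (auto simp: funpow_swap1 arg_Suc_Suc All_less_Suc2)
  have "B \<in> apps_sem d (e # ds) \<longleftrightarrow> (\<exists>C\<in>app d e. ?P C)"
    using Cons.IH[of "app d e"] Cons.prems by (simp add: up_app)
  also have "\<dots> \<longleftrightarrow> (\<exists>C\<in>d. ?Q C)"
  proof
    assume "\<exists>C\<in>app d e. ?P C"
    then obtain C s where C: "Arr s C \<in> d" "set s \<subseteq> e" "?P C"
      by (auto simp: app_def)
    then have "?Q (Arr s C)"
      unfolding Q src.simps tgt.simps by blast
    with C(1) show "\<exists>C\<in>d. ?Q C" by blast
  next
    assume "\<exists>C\<in>d. ?Q C"
    then obtain C where C: "C \<in> d" "?P (tgt C)" "set (src C) \<subseteq> e"
      using Q by blast
    have "Arr (src C) (tgt C) \<in> d"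
      using upD[OF Cons.prems C(1) le_Arr_src_tgt] .
    then show "\<exists>C\<in>app d e. ?P C"
      using C by (intro bexI[of _ "tgt C"]) (auto simp: app_def)
  qed
  finally show ?case .
qed

lemma nth_map_upt_1: "i \<in> {1..n} \<Longrightarrow> map f [1..<Suc n] ! (i - 1) = f i"
  by (cases i) (simp_all del: upt_Suc)

lemma apps_sem_eta:
  assumes "up d"
  shows "A \<in> d \<longleftrightarrow> (tgt ^^ n) A \<in> apps_sem d (map (\<lambda>i. upc (arg i A)) [1..<Suc n])"
proof (induction n)
  case (Suc n)
  let ?e = "apps_sem d (map (\<lambda>i. upc (arg i A)) [1..<Suc n])"
  have "(tgt ^^ n) A \<in> ?e \<longleftrightarrow> (tgt ^^ Suc n) A \<in> app ?e (upc (src ((tgt ^^ n) A)))"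
    using app_eta[OF up_apps_sem[OF assms]] by simp
  then show ?case using Suc by (simp add: arg_def)
qed simp

text \<open>\<open>act t d e\<close>: the value \<open>e\<close> behaves like \<open>t\<^sup>+\<close> applied to \<open>d\<close>.\<close>

coinductive act :: "ptree \<Rightarrow> ty set \<Rightarrow> ty set \<Rightarrow> bool" where
  "\<lbrakk>up d; up e;
    \<And>ds. length ds = arity t \<Longrightarrow> \<forall>d\<in>set ds. up d \<Longrightarrow>
      \<exists>es. length es = arity t \<and> apps_sem e ds = apps_sem d es \<and>
        (\<forall>i\<in>{1..arity t}. act (child t i) (ds ! (label t i - 1)) (es ! (i - 1)))\<rbrakk>
   \<Longrightarrow> act t d e"

lemma act_up: "act t d e \<Longrightarrow> up d \<and> up e"
  by (auto elim: act.cases)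

lemma act_eps: "up d \<Longrightarrow> act eps d d"
  by (rule act.intros) auto

text \<open>Eta-expansion: beyond the arity of \<open>t\<close> the children are \<open>eps\<close>
  and the label is the identity, so the extra arguments are passed on unchanged.\<close>

lemma act_unfold:
  assumes "act t d e" "t \<in> PT" "arity t \<le> length ds" "\<forall>d\<in>set ds. up d"
  obtains es where "length es = length ds" "apps_sem e ds = apps_sem d es"
    "\<And>i. i \<in> {1..length ds} \<Longrightarrow> act (child t i) (ds ! (label t i - 1)) (es ! (i - 1))"
proof -
  let ?n = "arity t"
  have ds: "ds = take ?n ds @ drop ?n ds" by simp
  have "length (take ?n ds) = ?n" "\<forall>d\<in>set (take ?n ds). up d"
    using assms(3,4) by (auto dest: in_set_takeD)
  then obtain es where es: "length es = ?n" "apps_sem e (take ?n ds) = apps_sem d es"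
    "\<forall>i\<in>{1..?n}. act (child t i) (take ?n ds ! (label t i - 1)) (es ! (i - 1))"
    using assms(1) by (elim act.cases) blast
  have "apps_sem e ds = apps_sem d (es @ drop ?n ds)"
    by (subst ds, subst foldl_append) (simp add: es(2))
  moreover have "act (child t i) (ds ! (label t i - 1)) ((es @ drop ?n ds) ! (i - 1))"
    if "i \<in> {1..length ds}" for i
  proof (cases "i \<le> ?n")
    case True
    then have "label t i \<in> {1..?n}" using PT_label_in[OF assms(2)] that by simp
    then have "label t i - 1 < ?n" "i - 1 < ?n" using that True by auto
    moreover have "act (child t i) (take ?n ds ! (label t i - 1)) (es ! (i - 1))"
      using es(3) True that by auto
    ultimately show ?thesis using es(1) by (simp add: nth_append)
  next
    case False
    then have "act eps (ds ! (i - 1)) (ds ! (i - 1))"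
      using assms(4) that by (intro act_eps) auto
    then show ?thesis
      using False that label_beyond[OF assms(2)] es(1) by (auto simp: nth_append child_beyond)
  qed
  moreover have "length (es @ drop ?n ds) = length ds" using es(1) assms(3) by simp
  ultimately show thesis using that by blast
qed

lemma lab_child: "(\<lambda>w. lab t (i # w)) = lab (child t i)"
  by auto

text \<open>Only \<open>lab t\<close> and the generators \<open>s\<close> determine
  \<open>e\<close>; the arities have disappeared. At a child the roles are exchanged: argument types
  of \<open>A\<close> become the generators, and an argument type of a member of \<open>s\<close> is
  tested, which decreases the total size.\<close>

lemma act_iff_rel:
  assumes "t \<in> PT" "act t (upc s) e"
  shows "A \<in> e \<longleftrightarrow> (\<exists>C\<in>set s. rel (lab t) C A)"
  using assms
proof (induction "size_list size s + size A" arbitrary: t s e A rule: less_induct)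
  case less
  let ?n = "arity t"
  \<comment> \<open>By extensionality it suffices to test \<open>e\<close> on the arguments that
    \<open>A\<close> itself lists; they are finitely generated, as the induction hypothesis
    requires.\<close>
  let ?ds = "map (\<lambda>i. upc (arg i A)) [1..<Suc ?n]"
  note t = less.prems(1)
  have up: "up e" using act_up[OF less.prems(2)] by simp
  have ds_nth: "?ds ! (i - 1) = upc (arg i A)" if "i \<in> {1..?n}" for i
    by (rule nth_map_upt_1[OF that])
  have ds: "length ?ds = ?n" "\<forall>d\<in>set ?ds. up d"
    by (simp_all del: upt_Suc)
  obtain es where es: "length es = ?n" "apps_sem e ?ds = apps_sem (upc s) es"
    "\<And>i. i \<in> {1..?n} \<Longrightarrow> act (child t i) (?ds ! (label t i - 1)) (es ! (i - 1))"
    by (rule act_unfold[OF less.prems(2) t _ ds(2)]) (simp only: ds(1), simp only: ds(1))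
  have act: "act (child t i) (upc (arg (label t i) A)) (es ! (i - 1))" if "i \<in> {1..?n}" for i
    using es(3)[OF that] ds_nth[OF PT_label_in[OF t that]] by simp
  have up_es: "up (es ! i)" if "i < ?n" for i
    using act_up[OF act[of "Suc i"]] that by simp
  have IH: "c \<in> es ! (i - 1) \<longleftrightarrow> (\<exists>a\<in>set (arg (label t i) A). rel (\<lambda>w. lab t (i # w)) a c)"
    if "C \<in> set s" "c \<in> set (arg i C)" "i \<in> {1..?n}" for C c i
  proof -
    have "size c < size_list size s"
      using size_in_arg[OF that(2)] size_in_list[OF that(1)] by simp
    then have "size_list size (arg (label t i) A) + size c < size_list size s + size A"
      using size_arg[of "label t i" A] by simp
    from less.hyps[OF this child_PT[OF t] act[OF that(3)]] show ?thesis
      by (simp add: lab_child)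
  qed
  have beyond: "label t i = i \<and> (\<lambda>w. lab t (i # w)) = (\<lambda>_ i. i)" if "?n < i" for i
    using label_beyond[OF t that] that by (simp add: child_beyond fun_eq_iff)
  \<comment> \<open>Up to index \<open>?n\<close> the condition of \<open>rel\<close> turns into
    membership in \<open>es\<close> by \<open>IH\<close>. Beyond \<open>?n\<close> the children are
    \<open>eps\<close>, and what remains is subtyping of the targets.\<close>
  have key: "rel (lab t) C A \<longleftrightarrow> le ((tgt ^^ ?n) C) ((tgt ^^ ?n) A) \<and>
      (\<forall>i<?n. set (arg (Suc i) C) \<subseteq> es ! i)" if C: "C \<in> set s" for C
  proof -
    define R where "R i \<longleftrightarrow> (\<forall>c\<in>set (arg i C). \<exists>a\<in>set (arg (label t i) A). rel (\<lambda>w. lab t (i # w)) a c)" for i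
    define S where "S i \<longleftrightarrow> (\<forall>c\<in>set (arg i ((tgt ^^ ?n) C)). \<exists>a\<in>set (arg i ((tgt ^^ ?n) A)). le a c)" for i
    have "rel (lab t) C A \<longleftrightarrow> (\<forall>i. R i)"
      unfolding R_def by (subst rel_iff) simp
    also have "\<dots> \<longleftrightarrow> (\<forall>i. S i) \<and> (\<forall>i<?n. R (Suc i))"
    proof -
      have S: "S (Suc i) = R (Suc i + ?n)" for i
        unfolding S_def R_def using beyond[of "Suc i + ?n"] by (simp add: arg_tgt_pow)
      have S0: "S 0" and R0: "R 0"
        by (simp_all add: S_def R_def)
      have "R i" if "\<And>i. S i" "\<And>i. i < ?n \<Longrightarrow> R (Suc i)" for i
      proof (cases i)
        case (Suc j)
        show ?thesis
        proof (cases "j < ?n")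
          case False
          then have "i = Suc (j - ?n) + ?n" using Suc by simp
          then show ?thesis using that(1) S by metis
        qed (simp add: Suc that(2))
      qed (simp add: R0)
      moreover have "S i" if "\<And>i. R i" for i
        using that S S0 by (cases i) simp_all
      ultimately show ?thesis by blast
    qed
    also have "(\<forall>i. S i) \<longleftrightarrow> le ((tgt ^^ ?n) C) ((tgt ^^ ?n) A)"
      unfolding S_def by (rule le_iff[symmetric])
    also have "(\<forall>i<?n. R (Suc i)) \<longleftrightarrow> (\<forall>i<?n. set (arg (Suc i) C) \<subseteq> es ! i)"
    proof -
      have "R (Suc i) \<longleftrightarrow> set (arg (Suc i) C) \<subseteq> es ! i" if "i < ?n" for i
      proof -
        have "R (Suc i) \<longleftrightarrow> (\<forall>c\<in>set (arg (Suc i) C). c \<in> es ! (Suc i - 1))"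
          unfolding R_def by (rule ball_cong[OF refl], rule IH[OF C, symmetric]) (use that in simp_all)
        then show ?thesis by (simp add: subset_eq)
      qed
      then show ?thesis by simp
    qed
    finally show ?thesis .
  qed
  have "A \<in> e \<longleftrightarrow> (tgt ^^ ?n) A \<in> apps_sem (upc s) es"
    using apps_sem_eta[OF up, of A ?n] es(2) by simp
  also have "\<dots> \<longleftrightarrow> (\<exists>C\<in>upc s. le ((tgt ^^ ?n) C) ((tgt ^^ ?n) A) \<and>
      (\<forall>i<?n. set (arg (Suc i) C) \<subseteq> es ! i))"
    by (simp add: apps_sem_iff es(1))
  \<comment> \<open>\<open>key\<close> speaks of generators only; a type in \<open>upc s\<close> can
    be replaced by a generator below it because the members of \<open>es\<close> are upward
    closed.\<close>
  also have "\<dots> \<longleftrightarrow> (\<exists>C\<in>set s. le ((tgt ^^ ?n) C) ((tgt ^^ ?n) A) \<and>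
      (\<forall>i<?n. set (arg (Suc i) C) \<subseteq> es ! i))" (is "(\<exists>C\<in>upc s. ?P C) \<longleftrightarrow> _")
  proof
    assume "\<exists>C\<in>upc s. ?P C"
    then obtain C C' where C: "C \<in> set s" "le C C'" "?P C'"
      by (auto simp: upc_def)
    have "set (arg (Suc i) C) \<subseteq> es ! i" if "i < ?n" for i
    proof
      fix c assume "c \<in> set (arg (Suc i) C)"
      then obtain c' where "c' \<in> set (arg (Suc i) C')" "le c' c"
        using C(2) by (subst (asm) le_iff) blast
      moreover from this have "c' \<in> es ! i"
        using C(3) that by blast
      ultimately show "c \<in> es ! i"
        using upD[OF up_es[OF that]] by blast
    qed
    moreover have "le ((tgt ^^ ?n) C) ((tgt ^^ ?n) A)"
      using le_trans[OF le_tgt_pow[OF C(2)]] C(3) by blast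
    ultimately show "\<exists>C\<in>set s. ?P C" using C(1) by blast
  next
    assume "\<exists>C\<in>set s. ?P C"
    then show "\<exists>C\<in>upc s. ?P C"
      unfolding upc_def using le_refl by blast
  qed
  also have "\<dots> \<longleftrightarrow> (\<exists>C\<in>set s. rel (lab t) C A)"
    by (rule bex_cong[OF refl], rule key[symmetric])
  finally show ?case .
qed

section \<open>The values of hereditary permutations\<close>

text \<open>\<open>e\<close> is the value of a head normal form with Boehm tree \<open>pt_body k t\<close>, and \<open>d\<close> that of its head
  variable.\<close>

inductive hnf_values :: "ptree \<Rightarrow> ty set \<Rightarrow> ty set \<Rightarrow> bool" where
  "\<lbrakk>t \<in> PT; length Ms = arity t; \<And>i. up (\<rho> i);
    \<And>i. i \<in> {1..arity t} \<Longrightarrow> BT (Ms ! (i - 1)) = pt_body (arity t - label t i) (child t i)\<rbrakk>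
   \<Longrightarrow> hnf_values t (\<rho> k) (sem (lams (arity t) (apps (Var (k + arity t)) Ms)) \<rho>)"

lemma BT_body:
  assumes "BT M = Hnf m h (map (\<lambda>i. pt_body (arity t - label t i) (child t i)) [1..<Suc (arity t)])"
  obtains Ms where "beta\<^sup>*\<^sup>* M (lams m (apps (Var h) Ms))" "length Ms = arity t"
    "\<And>i. i \<in> {1..arity t} \<Longrightarrow> BT (Ms ! (i - 1)) = pt_body (arity t - label t i) (child t i)"
proof -
  let ?n = "arity t"
  obtain Ms where Ms: "head_red\<^sup>*\<^sup>* M (lams m (apps (Var h) Ms))"
    "map BT Ms = map (\<lambda>i. pt_body (?n - label t i) (child t i)) [1..<Suc ?n]"
    using assms by (elim BT_Hnf) (simp only:)
  have len: "length Ms = ?n"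
    using arg_cong[OF Ms(2), of length] by (simp del: upt_Suc)
  have "BT (Ms ! (i - 1)) = pt_body (?n - label t i) (child t i)" if "i \<in> {1..?n}" for i
  proof -
    have "map BT Ms ! (i - 1) = pt_body (?n - label t i) (child t i)"
      unfolding Ms(2) by (rule nth_map_upt_1[OF that])
    then show ?thesis using that len by auto
  qed
  then show thesis using that[OF head_reds_imp_betas[OF Ms(1)] len] by blast
qed

lemma hnf_values_sem:
  assumes "t \<in> PT" "BT M = pt_body k t" and up: "\<And>i. up (\<rho> i)"
  shows "hnf_values t (\<rho> k) (sem M \<rho>)"
proof -
  let ?n = "arity t"
  have "BT M = Hnf ?n (k + ?n) (map (\<lambda>i. pt_body (?n - label t i) (child t i)) [1..<Suc ?n])"
    unfolding assms(2) by (rule pt_body.code)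
  then obtain Ms where Ms: "beta\<^sup>*\<^sup>* M (lams ?n (apps (Var (k + ?n)) Ms))" "length Ms = ?n"
    "\<And>i. i \<in> {1..?n} \<Longrightarrow> BT (Ms ! (i - 1)) = pt_body (?n - label t i) (child t i)"
    by (rule BT_body) blast
  have "sem M \<rho> = sem (lams ?n (apps (Var (k + ?n)) Ms)) \<rho>"
    by (rule betas_sem[OF Ms(1) up])
  then show ?thesis
    using hnf_values.intros[of t Ms \<rho> k, OF assms(1) Ms(2) up Ms(3)] by simp
qed

lemma hnf_values_imp_act: "hnf_values t d e \<Longrightarrow> act t d e"
proof (rule act.coinduct[of hnf_values])
  fix t d e assume "hnf_values t d e"
  then show "\<exists>d' e' t'. t = t' \<and> d = d' \<and> e = e' \<and> up d' \<and> up e' \<and>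
    (\<forall>ds. length ds = arity t' \<longrightarrow> (\<forall>d\<in>set ds. up d) \<longrightarrow>
      (\<exists>es. length es = arity t' \<and> apps_sem e' ds = apps_sem d' es \<and>
        (\<forall>i\<in>{1..arity t'}. hnf_values (child t' i) (ds ! (label t' i - 1)) (es ! (i - 1)) \<or>
          act (child t' i) (ds ! (label t' i - 1)) (es ! (i - 1)))))"
  proof cases
    case (1 Ms \<rho> k)
    note d = 1(1) and e = 1(2) and t = 1(3) and len = 1(4) and up = 1(5) and BT = 1(6)
    let ?n = "arity t"
    have step: "\<exists>es. length es = ?n \<and> apps_sem e ds = apps_sem d es \<and>
        (\<forall>i\<in>{1..?n}. hnf_values (child t i) (ds ! (label t i - 1)) (es ! (i - 1)) \<or>
          act (child t i) (ds ! (label t i - 1)) (es ! (i - 1)))"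
      if ds: "length ds = ?n" "\<forall>d\<in>set ds. up d" for ds
    \<comment> \<open>The witnesses are the values of the arguments \<open>Ms\<close> once the
      binders have received \<open>ds\<close>.\<close>
    proof (intro exI[of _ "map (\<lambda>M. sem M (push ds \<rho>)) Ms"] conjI ballI)
      have push_up: "up (push ds \<rho> i)" for i using up_push[OF ds(2)] up by blast
      show "length (map (\<lambda>M. sem M (push ds \<rho>)) Ms) = ?n" by (simp add: len)
      have "push ds \<rho> (k + ?n) = \<rho> k" by (simp add: push_def ds(1))
      then show "apps_sem e ds = apps_sem d (map (\<lambda>M. sem M (push ds \<rho>)) Ms)"
        using apps_sem_lams[OF ds(2), of "apps (Var (k + ?n)) Ms" \<rho>] ds(1) by (simp add: d e sem_apps)
      fix i assume i: "i \<in> {1..?n}"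
      let ?k = "?n - label t i"
      have "label t i \<in> {1..?n}" using PT_label_in[OF t i] .
      \<comment> \<open>Index \<open>?k\<close> belongs to binder number \<open>label t i\<close>,
        whose value is entry \<open>label t i - 1\<close> of \<open>ds\<close>.\<close>
      then have "?k < ?n" "?n - Suc ?k = label t i - 1" by auto
      then have "ds ! (label t i - 1) = push ds \<rho> ?k" using ds(1) by (simp add: push_def)
      moreover have "map (\<lambda>M. sem M (push ds \<rho>)) Ms ! (i - 1) = sem (Ms ! (i - 1)) (push ds \<rho>)"
        using i len by auto
      ultimately show "hnf_values (child t i) (ds ! (label t i - 1)) (map (\<lambda>M. sem M (push ds \<rho>)) Ms ! (i - 1)) \<or>
          act (child t i) (ds ! (label t i - 1)) (map (\<lambda>M. sem M (push ds \<rho>)) Ms ! (i - 1))"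
        using hnf_values_sem[where \<rho> = "push ds \<rho>", OF child_PT[OF t] BT[OF i] push_up] by simp
    qed
    have "up d" unfolding d by (rule up)
    moreover have "up e" unfolding e by (rule up_sem) (rule up)
    ultimately show ?thesis
      using step by - (rule exI[of _ d], rule exI[of _ e], rule exI[of _ t], simp)
  qed
qed assumption

text \<open>\<open>pt_plus t\<close> has one more leading binder than \<open>pt_body 0 t\<close>.
  Application to \<open>d\<close> consumes it and makes \<open>d\<close> the value of the head
  variable.\<close>

lemma act_HP:
  assumes "t \<in> PT" "BT M = pt_plus t" and up: "\<And>i. up (\<rho> i)" "up d"
  shows "act t d (app (sem M \<rho>) d)"
proof -
  let ?n = "arity t" and ?\<rho> = "case_nat d \<rho>"
  have up': "up (?\<rho> i)" for i
    using up by (simp split: nat.split)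
  have "BT M = Hnf (Suc ?n) ?n (map (\<lambda>i. pt_body (?n - label t i) (child t i)) [1..<Suc ?n])"
    unfolding assms(2) pt_plus_def by (subst pt_body.code) simp
  then obtain Ms where Ms: "beta\<^sup>*\<^sup>* M (lams (Suc ?n) (apps (Var ?n) Ms))" "length Ms = ?n"
    "\<And>i. i \<in> {1..?n} \<Longrightarrow> BT (Ms ! (i - 1)) = pt_body (?n - label t i) (child t i)"
    by (rule BT_body) blast
  have "sem M \<rho> = sem (Lam (lams ?n (apps (Var ?n) Ms))) \<rho>"
    using betas_sem[where \<rho> = \<rho>, OF Ms(1) up(1)] by simp
  then have "app (sem M \<rho>) d = sem (lams ?n (apps (Var (0 + ?n)) Ms)) ?\<rho>"
    using app_Lam[OF up(2)] by (simp del: sem.simps(3))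
  then show ?thesis
    using hnf_values_imp_act[OF hnf_values.intros[of t Ms ?\<rho> 0, OF assms(1) Ms(2) up' Ms(3)]] by simp
qed

text \<open>By extensionality it is enough to apply both values to finitely generated filters, where
  \<open>act_iff_rel\<close> describes the results by \<open>lab\<close> alone.\<close>

lemma lab_eq_imp_sem_eq:
  assumes "t \<in> PT" "u \<in> PT" "BT M = pt_plus t" "BT N = pt_plus u" "lab t = lab u"
    and up: "\<And>i. up (\<rho> i)"
  shows "sem M \<rho> = sem N \<rho>"
proof -
  have "tgt A \<in> app (sem M \<rho>) (upc (src A)) \<longleftrightarrow> tgt A \<in> app (sem N \<rho>) (upc (src A))" for A
    using act_iff_rel[OF assms(1) act_HP[where \<rho> = \<rho>, OF assms(1,3) up up_upc]]
      act_iff_rel[OF assms(2) act_HP[where \<rho> = \<rho>, OF assms(2,4) up up_upc]] assms(5) by simp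
  then show ?thesis
    using app_eta[OF up_sem, of \<rho> _ M] app_eta[OF up_sem, of \<rho> _ N] up by (auto simp del: id_apply)
qed

section \<open>The Boehm-out argument\<close>

definition selector :: "nat \<Rightarrow> nat \<Rightarrow> trm" where
  "selector p i = lams p (Var (p - i))"

lemma apps_sem_selector:
  assumes "i \<in> {1..length ds}" "\<forall>d\<in>set ds. up d"
  shows "apps_sem (sem (selector (length ds) i) \<rho>) ds = ds ! (i - 1)"
proof -
  have "length ds - i < length ds" "length ds - Suc (length ds - i) = i - 1"
    using assms(1) by auto
  then show ?thesis
    using apps_sem_lams[OF assms(2), of "Var (length ds - i)" \<rho>] by (simp add: selector_def push_def)
qed

text \<open>With a selector as the value of the head variable, the application of \<open>e\<close>
  to \<open>ds\<close> returns the \<open>i\<close>-th argument of the head.\<close>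

lemma act_select:
  assumes "act t (sem (selector p i) \<rho>) e" "t \<in> PT" "arity t \<le> p" "i \<in> {1..p}"
    and "length ds = p" "\<forall>d\<in>set ds. up d"
  shows "act (child t i) (ds ! (label t i - 1)) (apps_sem e ds)"
proof -
  obtain es where es: "length es = p" "apps_sem e ds = apps_sem (sem (selector p i) \<rho>) es"
    "\<And>i. i \<in> {1..p} \<Longrightarrow> act (child t i) (ds ! (label t i - 1)) (es ! (i - 1))"
    using act_unfold[OF assms(1,2), of ds] unfolding assms(5) using assms(3,6) by blast
  have "up (es ! j)" if "j < p" for j
    using act_up[OF es(3)[of "Suc j"]] that by simp
  then have "\<forall>d\<in>set es. up d"
    using es(1) by (auto simp: in_set_conv_nth)
  then have "apps_sem e ds = es ! (i - 1)"
    using apps_sem_selector[of i es] es(1,2) assms(4) by simp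
  then show ?thesis using es(3)[OF assms(4)] by simp
qed

lemma act_empty: "t \<in> PT \<Longrightarrow> act t {} e \<Longrightarrow> e = {}"
  using act_iff_rel[of t "[]" e] by auto

text \<open>\<open>Base\<close> generates all types, and it is related to itself for every tree
  because it has no arguments.\<close>

lemma act_UNIV: "t \<in> PT \<Longrightarrow> act t UNIV e \<Longrightarrow> e \<noteq> {}"
  using act_iff_rel[of t "[Base]" e Base] by (auto simp: upc_Base rel_iff[of _ Base])

text \<open>The conclusion says that exactly one of the two results is empty. Each letter of the
  word is followed by a selector in head position, and \<open>X\<close> is the selector for the
  first letter or, at the end of the word, for the index where the labels differ.\<close>

lemma boehm_out:
  assumes "t \<in> PT" "u \<in> PT" "lab t w \<noteq> lab u w"
  shows "\<exists>X As. \<forall>d e. act t (sem X top_env) d \<longrightarrow> act u (sem X top_env) e \<longrightarrow>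
    apps_sem d (map (\<lambda>M. sem M top_env) As) = {} \<longleftrightarrow> apps_sem e (map (\<lambda>M. sem M top_env) As) \<noteq> {}"
  using assms
proof (induction w arbitrary: t u)
  case Nil
  then obtain j where j: "label t j \<noteq> label u j" by auto
  define p where "p = max (arity t) (arity u)"
  have p: "arity t \<le> p" "arity u \<le> p" by (simp_all add: p_def)
  \<comment> \<open>Both labels fix \<open>0\<close> and everything above \<open>p\<close>, so they
    can only differ in between.\<close>
  have jp: "j \<in> {1..p}"
    using j label_0[OF Nil(1)] label_0[OF Nil(2)] label_beyond[OF Nil(1)] label_beyond[OF Nil(2)] p
    by (cases "j = 0"; cases "j \<le> p") auto
  \<comment> \<open>The selector returns the result of a child acting on the argument at
    \<open>label t j\<close> for \<open>t\<close> and at \<open>label u j\<close> for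
    \<open>u\<close>; only the former argument is \<open>omega\<close>.\<close>
  let ?As = "map (\<lambda>i. if i = label t j then omega else Var 0) [1..<Suc p]"
  let ?ds = "map (\<lambda>M. sem M top_env) ?As"
  have nth: "?ds ! (i - 1) = (if i = label t j then {} else UNIV)" if "i \<in> {1..p}" for i
    using nth_map_upt_1[OF that, of "\<lambda>i. sem (if i = label t j then omega else Var 0) top_env"]
    by (simp add: sem_omega comp_def del: upt_Suc)
  have ds: "length ?ds = p" "\<forall>d\<in>set ?ds. up d"
    by (auto intro: up_sem simp del: upt_Suc)
  have "apps_sem d ?ds = {} \<and> apps_sem e ?ds \<noteq> {}"
    if act: "act t (sem (selector p j) top_env) d" "act u (sem (selector p j) top_env) e" for d e
  proof
    have "act (child t j) {} (apps_sem d ?ds)"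
      using act_select[OF act(1) Nil(1) p(1) jp ds] nth[OF label_le[OF Nil(1) p(1) jp]] by simp
    then show "apps_sem d ?ds = {}" using act_empty child_PT Nil(1) by blast
    have "act (child u j) UNIV (apps_sem e ?ds)"
      using act_select[OF act(2) Nil(2) p(2) jp ds] nth[OF label_le[OF Nil(2) p(2) jp]] j by simp
    then show "apps_sem e ?ds \<noteq> {}" using act_UNIV child_PT Nil(2) by blast
  qed
  then show ?case by (intro exI[of _ "selector p j"] exI[of _ ?As]) blast
next
  case (Cons i w)
  define p where "p = max (arity t) (arity u)"
  have p: "arity t \<le> p" "arity u \<le> p" by (simp_all add: p_def)
  have ip: "i \<in> {1..p}"
    using Cons.prems(3) p by (cases "i = 0"; cases "i \<le> p") (auto simp: child_beyond)
  have "lab (child t i) w \<noteq> lab (child u i) w" using Cons.prems(3) by simp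
  from Cons.IH[OF child_PT[OF Cons.prems(1)] child_PT[OF Cons.prems(2)] this]
  obtain X As where X: "\<And>d e. act (child t i) (sem X top_env) d \<Longrightarrow> act (child u i) (sem X top_env) e \<Longrightarrow>
    apps_sem d (map (\<lambda>M. sem M top_env) As) = {} \<longleftrightarrow> apps_sem e (map (\<lambda>M. sem M top_env) As) \<noteq> {}"
    by blast
  \<comment> \<open>The child selected acts on the argument at \<open>label t i\<close> or
    \<open>label u i\<close>. These may differ, so all arguments are the term \<open>X\<close> for
    the rest of the word.\<close>
  let ?ds = "replicate p (sem X top_env)"
  have ds: "length ?ds = p" "\<forall>d\<in>set ?ds. up d"
    by (auto intro: up_sem)
  have nth: "?ds ! (j - 1) = sem X top_env" if "j \<in> {1..p}" for j
    using that by auto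
  have "apps_sem d (map (\<lambda>M. sem M top_env) (replicate p X @ As)) = {} \<longleftrightarrow>
      apps_sem e (map (\<lambda>M. sem M top_env) (replicate p X @ As)) \<noteq> {}"
    if act: "act t (sem (selector p i) top_env) d" "act u (sem (selector p i) top_env) e" for d e
    using X[of "apps_sem d ?ds" "apps_sem e ?ds"]
      act_select[OF act(1) Cons.prems(1) p(1) ip ds] nth[OF label_le[OF Cons.prems(1) p(1) ip]]
      act_select[OF act(2) Cons.prems(2) p(2) ip ds] nth[OF label_le[OF Cons.prems(2) p(2) ip]]
    by simp
  then show ?case by (intro exI[of _ "selector p i"] exI[of _ "replicate p X @ As"]) blast
qed

section \<open>Equality in H* as equality of labels\<close>

lemma H_star_imp_lab_eq:
  assumes "t \<in> PT" "u \<in> PT" "BT M = pt_plus t" "BT N = pt_plus u" "H_star M N"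
  shows "lab t = lab u"
proof (rule ccontr)
  assume "lab t \<noteq> lab u"
  then obtain w where "lab t w \<noteq> lab u w" by blast
  from boehm_out[OF assms(1,2) this] obtain X As where
    X: "\<And>d e. act t (sem X top_env) d \<Longrightarrow> act u (sem X top_env) e \<Longrightarrow>
      apps_sem d (map (\<lambda>M. sem M top_env) As) = {} \<longleftrightarrow> apps_sem e (map (\<lambda>M. sem M top_env) As) \<noteq> {}"
    by blast
  have "has_hnf (apps M (X # As)) \<longleftrightarrow> \<not> has_hnf (apps N (X # As))"
    using X[OF act_HP[where \<rho> = top_env, OF assms(1,3)] act_HP[where \<rho> = top_env, OF assms(2,4)]]
    by (simp add: has_hnf_iff_sem sem_apps up_sem)
  then show False using H_star_apps[OF assms(5)] by blast
qed

theorem H_star_iff_lab: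
  assumes "t \<in> PT" "u \<in> PT" "BT M = pt_plus t" "BT N = pt_plus u"
  shows "H_star M N \<longleftrightarrow> lab t = lab u"
  using H_star_imp_lab_eq[OF assms] sem_eq_imp_H_star[OF lab_eq_imp_sem_eq[OF assms]] by blast

lemma pt_of:
  assumes "M \<in> HP"
  shows "pt_of M \<in> PT" "BT M = pt_plus (pt_of M)"
  using theI'[OF ex1_pt_plus[OF assms]] by (simp_all add: pt_of_def)

theorem theorem4p6:
  fixes M N :: trm
  assumes "M \<in> HP" and "N \<in> HP"
  shows "(H_star M N \<longleftrightarrow> sigma_PT (pt_of M) (pt_of N)) \<and>
         (sigma_PT (pt_of M) (pt_of N) \<longleftrightarrow> mform (pt_of M) = mform (pt_of N))"
  using H_star_iff_lab sigma_PT_iff_lab mform_eq_iff_lab pt_of[OF assms(1)] pt_of[OF assms(2)]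
  by simp

end
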